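(* For every $r\in\mathbb{R}$, the random time $$T_r:=\begin{cases}\sup\{t\ge 0:\ \ell^0[0,t]=r\}, & r\ge 0,\\ \sup\{t<0:\ \ell^0[t,0]=-r\}, & r<0,\end{cases}$$ is an unbiased shift embedding $\delta_0$ (the unit mass at $0$).
   Context: Let $\Omega$ be the set of continuous functions $\omega:\mathbb{R}\to\mathbb{R}$ with the Kolmogorov product $\sigma$-algebra $\mathcal{A}$, let $B=(B_t)_{t\in\mathbb{R}}$ be the identity (coordinate process) on $\Omega$, and let $\mathbb{P}_0$ be the law of a two-sided standard Brownian motion with $B_0=0$. Put $\mathbb{P}_x:=\mathbb{P}_0\{B+x\in\cdot\}$ for $x\in\mathbb{R}$, and $(\theta_t\omega)_s:=\omega_{t+s}$ for $s,t\in\mathbb{R}$. Random times. A random time is a measurable function $T$ of $B$ with values in $\mathbb{R}$ (a time given by a formula that may be infinite on a $\mathbb{P}_0$-null set is understood up to that null set). $T$ is an unbiased shift if, under $\mathbb{P}_0$, $(B_{T+t}-B_T)_{t\in\mathbb{R}}$ is a two-sided standard Brownian motion independent of $B_T$. $T$ embeds a probability measure $\nu$ on $\mathbb{R}$ if $B_T$ has distribution $\nu$ under $\mathbb{P}_0$. Local times. $\ell^x$ denotes the random measure on $\mathbb{R}$ associated with the local time of $B$ at $x\in\mathbb{R}$: for all measurable $f:\mathbb{R}^2\to[0,\infty)$, $\int f(B_s,s)\,ds=\iint f(x,s)\,\ell^x(ds)\,dx$, $\mathbb{P}_0$-a.s. A version is fixed such that: $\ell^0$ is $\mathbb{P}_x$-a.e.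 diffuse (atomless) for every $x$; $\ell^0(\theta_t\omega,C-t)=\ell^0(\omega,C)$ for all Borel $C\subset\mathbb{R}$ and $t\in\mathbb{R}$, $\mathbb{P}_x$-a.s. for every $x$; $\ell^y(\omega,\cdot)=\ell^0(\omega-y,\cdot)$ for all $\omega,y$; and $\int \mathbf{1}\{B_t\neq x\}\,\ell^x(\omega,dt)=0$ for all $\omega,x$. *)

theory Defs
  imports "HOL-Probability.Probability"
begin

type_synonym path = "real \<Rightarrow> real"

definition \<Omega> :: "path measure" where
  "\<Omega> = restrict_space (PiM UNIV (\<lambda>_. borel)) {\<omega>. continuous_on UNIV \<omega>}"

definition shift :: "real \<Rightarrow> path \<Rightarrow> path" where
  "shift t \<omega> = (\<lambda>s. \<omega> (t + s))"

text \<open>Measurability into \<^term>\<open>\<Omega>\<close> includes continuity of every path.\<close>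

definition two_sided_standard_BM :: "'a measure \<Rightarrow> ('a \<Rightarrow> path) \<Rightarrow> bool" where
  "two_sided_standard_BM M X \<longleftrightarrow>
     prob_space M \<and>
     X \<in> M \<rightarrow>\<^sub>M \<Omega> \<and>
     (AE \<omega> in M. X \<omega> 0 = 0) \<and>
     (\<forall>s t. s < t \<longrightarrow>
        distributed M lborel (\<lambda>\<omega>. X \<omega> t - X \<omega> s) (normal_density 0 (sqrt (t - s)))) \<and>
     (\<forall>(n::nat) (t::nat \<Rightarrow> real). strict_mono_on {..n} t \<longrightarrow>
        prob_space.indep_vars M (\<lambda>_. borel) (\<lambda>i \<omega>. X \<omega> (t (Suc i)) - X \<omega> (t i)) {..<n})"

definition law_of_two_sided_standard_BM :: "path measure \<Rightarrow> bool" where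
  "law_of_two_sided_standard_BM P0 \<longleftrightarrow>
     sets P0 = sets \<Omega> \<and> two_sided_standard_BM P0 (\<lambda>\<omega>. \<omega>)"

definition started_at :: "path measure \<Rightarrow> real \<Rightarrow> path measure" where
  "started_at P0 x = distr P0 \<Omega> (\<lambda>\<omega> t. \<omega> t + x)"

definition random_time :: "(path \<Rightarrow> real) \<Rightarrow> bool" where
  "random_time T \<longleftrightarrow> T \<in> borel_measurable \<Omega>"

text \<open>Independence is stated for the generated \<open>\<sigma>\<close>-algebras because
  \<^const>\<open>prob_space.indep_var\<close> requires both variables to have the same value type.\<close>

definition unbiased_shift :: "path measure \<Rightarrow> (path \<Rightarrow> real) \<Rightarrow> bool" where
  "unbiased_shift P0 T \<longleftrightarrow>
     random_time T \<and>
     two_sided_standard_BM P0 (\<lambda>\<omega> t. \<omega> (T \<omega> + t) - \<omega> (T \<omega>)) \<and>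
     prob_space.indep_set P0
       {(\<lambda>\<omega> t. \<omega> (T \<omega> + t) - \<omega> (T \<omega>)) -` A \<inter> space P0 | A. A \<in> sets \<Omega>}
       {(\<lambda>\<omega>. \<omega> (T \<omega>)) -` C \<inter> space P0 | C. C \<in> sets (borel :: real measure)}"

definition embeds :: "path measure \<Rightarrow> (path \<Rightarrow> real) \<Rightarrow> real measure \<Rightarrow> bool" where
  "embeds P0 T \<nu> \<longleftrightarrow> distr P0 borel (\<lambda>\<omega>. \<omega> (T \<omega>)) = \<nu>"

text \<open>A random measure is a kernel from \<^term>\<open>\<Omega>\<close> to the line which is locally finite outside
  a set that is null under each \<open>\<P>\<^sub>x\<close>.\<close>

definition random_measure :: "path measure \<Rightarrow> (path \<Rightarrow> real measure) \<Rightarrow> bool" where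
  "random_measure P0 \<xi> \<longleftrightarrow>
     (\<forall>\<omega>\<in>space \<Omega>. sets (\<xi> \<omega>) = sets borel) \<and>
     (\<forall>C\<in>sets borel. (\<lambda>\<omega>. emeasure (\<xi> \<omega>) C) \<in> borel_measurable \<Omega>) \<and>
     (\<forall>x. AE \<omega> in started_at P0 x. \<forall>K. compact K \<longrightarrow> emeasure (\<xi> \<omega>) K < \<infinity>)"

definition occupation_formula :: "path measure \<Rightarrow> (real \<Rightarrow> path \<Rightarrow> real measure) \<Rightarrow> bool" where
  "occupation_formula P0 l \<longleftrightarrow>
     (\<forall>f::real \<times> real \<Rightarrow> real. f \<in> borel_measurable borel \<and> (\<forall>p. 0 \<le> f p) \<longrightarrow>
        (AE \<omega> in P0. (\<integral>\<^sup>+s. ennreal (f (\<omega> s, s)) \<partial>lborel) =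
           (\<integral>\<^sup>+x. (\<integral>\<^sup>+s. ennreal (f (x, s)) \<partial>l x \<omega>) \<partial>lborel)))"

text \<open>\<open>l x \<omega>\<close> is the measure \<open>\<ell>\<^sup>x(\<omega>, \<cdot>)\<close>.  Exceptional null sets may depend on the test
  function \<open>f\<close> above and on \<open>t\<close> and \<open>C\<close> below, which is the weakest reading of
  the requirements.\<close>

definition local_time :: "path measure \<Rightarrow> (real \<Rightarrow> path \<Rightarrow> real measure) \<Rightarrow> bool" where
  "local_time P0 l \<longleftrightarrow>
     (\<forall>x. random_measure P0 (l x)) \<and>
     occupation_formula P0 l \<and>
     (\<forall>x. AE \<omega> in started_at P0 x. \<forall>t. emeasure (l 0 \<omega>) {t} = 0) \<and>
     (\<forall>x t. \<forall>C\<in>sets borel. AE \<omega> in started_at P0 x.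
        emeasure (l 0 (shift t \<omega>)) ((\<lambda>s. s - t) ` C) = emeasure (l 0 \<omega>) C) \<and>
     (\<forall>y. \<forall>\<omega>\<in>space \<Omega>. l y \<omega> = l 0 (\<lambda>s. \<omega> s - y)) \<and>
     (\<forall>x. \<forall>\<omega>\<in>space \<Omega>. (\<integral>\<^sup>+t. indicator {t. \<omega> t \<noteq> x} t \<partial>l x \<omega>) = 0)"

text \<open>The suprema are taken in the extended reals, so that they are meaningful for every path:
  the value is \<open>-\<infinity>\<close> for an empty set and \<open>\<infinity>\<close> for an unbounded one.\<close>

definition inverse_local_time ::
    "(real \<Rightarrow> path \<Rightarrow> real measure) \<Rightarrow> real \<Rightarrow> path \<Rightarrow> ereal" where
  "inverse_local_time l r \<omega> =
     (if 0 \<le> r then Sup (ereal ` {t. 0 \<le> t \<and> emeasure (l 0 \<omega>) {0..t} = ennreal r})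
      else Sup (ereal ` {t. t < 0 \<and> emeasure (l 0 \<omega>) {t..0} = ennreal (- r)}))"

text \<open>A time given by an extended-valued formula is identified with the (real-valued) random times
  that agree with it almost surely.\<close>

definition random_time_version :: "path measure \<Rightarrow> (path \<Rightarrow> ereal) \<Rightarrow> (path \<Rightarrow> real) \<Rightarrow> bool" where
  "random_time_version P0 S T \<longleftrightarrow> random_time T \<and> (AE \<omega> in P0. ereal (T \<omega>) = S \<omega>)"

end

theory Submission
  imports Defs
begin

text \<open>Let \<open>Q\<close> be the shift-invariant \<open>\<sigma>\<close>-finite measure \<open>\<integral> P\<^sub>x dx\<close>.  The occupation formula says that
  \<open>P0\<close> is the Palm measure of \<open>\<ell>\<^sup>0\<close> under \<open>Q\<close>.  Moving every point \<open>s\<close> to the right by \<open>\<ell>\<^sup>0\<close>-mass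
  \<open>r\<close> preserves the diffuse measure \<open>\<ell>\<^sup>0\<close>, and seen from \<open>s\<close> the target is the inverse local
  time at \<open>r\<close>; hence \<open>P0\<close> is invariant under the shift by \<open>T\<^sub>r\<close>.  That \<open>\<ell>\<^sup>0\<close> has infinite mass on
  both half-lines follows from the absence of wandering sets of positive \<open>Q\<close>-measure.\<close>

subsection \<open>Generalized inverses of diffuse measures on the line\<close>

text \<open>The hypotheses on the local time are almost sure statements whose null sets may depend
  on the shift and on the test set, whereas the transport needs them at almost every point charged
  by the local time of one path. Countable families, Fubini and the Palm formula itself supply the
  upgrade. In the clock coordinate u = \<open>cumul \<mu> s\<close> a diffuse measure becomes
  Lebesgue measure and moving by mass r becomes u -> u + r, which is why it is preserved. The Palm
  formula rests on two facts: the path vanishes at the points charged by the local time, so shifting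
  there agrees with shifting and recentring vertically; and the path recentred at a fixed time is
  again Brownian. Recurrence enters only through wandering sets: a finite nonzero tail of the local
  time crosses a mass level once along the shift orbit, and the paths caught at the crossing form
  such a set. Once P0 is invariant under the shift by T_r, the path is 0 at T_r because it is 0 at
  time 0. This embeds the unit mass at 0, identifies the increment path with the shifted path, and
  leaves only independence from an almost surely constant variable.\<close>

definition cumul :: "real measure \<Rightarrow> real \<Rightarrow> real" where
  "cumul \<mu> t = measure \<mu> {0<..<t} - measure \<mu> {t<..<0}"

text \<open>For a clock the strict inequality selects the last time at level r, the right-continuous
  inverse, in agreement with the suprema that define T_r.\<close>

definition cumul_inv :: "real measure \<Rightarrow> real \<Rightarrow> real" where
  "cumul_inv \<mu> r = Inf {t. r < cumul \<mu> t}"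

text \<open>Local finiteness and absence of atoms make \<open>cumul \<mu>\<close> continuous;
  infinite mass on both sides makes it onto the real line, so every level has a finite
  inverse.\<close>

locale clock =
  fixes \<mu> :: "real measure"
  assumes sets_eq [measurable_cong]: "sets \<mu> = sets borel"
    and finite_Icc: "emeasure \<mu> {a..b} < \<infinity>"
    and diffuse: "emeasure \<mu> {t} = 0"
    and infinite_right: "emeasure \<mu> {0<..} = \<infinity>"
    and infinite_left: "emeasure \<mu> {..<0} = \<infinity>"
begin

lemma space_eq: "space \<mu> = UNIV"
  using sets_eq_imp_space_eq[OF sets_eq] by simp

lemma finite_subset_Icc: "A \<in> sets borel \<Longrightarrow> A \<subseteq> {a..b} \<Longrightarrow> emeasure \<mu> A \<noteq> \<infinity>"
  using emeasure_mono[of A "{a..b}" \<mu>] finite_Icc[of a b] sets_eq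
  by (metis atLeastAtMost_borel infinity_ennreal_def leD top.not_eq_extremum)

lemma emeasure_eq_measure_bdd: "A \<in> sets borel \<Longrightarrow> A \<subseteq> {a..b} \<Longrightarrow> emeasure \<mu> A = ennreal (measure \<mu> A)"
  using finite_subset_Icc[of A a b] by (intro emeasure_eq_ennreal_measure) auto

lemma measure_singleton: "measure \<mu> {t} = 0"
  by (simp add: measure_def diffuse)

lemma measure_disjoint_Un:
  assumes "A \<in> sets borel" "B \<in> sets borel" "A \<inter> B = {}" "A \<subseteq> {a..b}" "B \<subseteq> {a..b}" "A \<union> B = C"
  shows "measure \<mu> C = measure \<mu> A + measure \<mu> B"
  using measure_Union[of \<mu> A B] finite_subset_Icc[of A a b] finite_subset_Icc[of B a b] assms sets_eq
  by auto

lemma measure_Ioo_split: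
  assumes "a < b" "b < c" shows "measure \<mu> {a<..<c} = measure \<mu> {a<..<b} + measure \<mu> {b<..<c}"
proof -
  have "measure \<mu> {a<..<c} = measure \<mu> {a<..b} + measure \<mu> {b<..<c}"
    by (rule measure_disjoint_Un[of _ _ a c]) (use assms in auto)
  moreover have "measure \<mu> {a<..b} = measure \<mu> {a<..<b} + measure \<mu> {b}"
    by (rule measure_disjoint_Un[of _ _ a b]) (use assms in auto)
  ultimately show ?thesis by (simp add: measure_singleton)
qed

lemma cumul_diff:
  assumes "a \<le> b" shows "cumul \<mu> b - cumul \<mu> a = measure \<mu> {a<..<b}"
proof -
  consider "a = b" | "a < b" "0 < a" | "a = 0" "a < b" | "a < 0" "b = 0" | "a < 0" "0 < b" | "a < b" "b < 0"
    using assms by linarith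
  then show ?thesis
  proof cases
    case 2 then show ?thesis using measure_Ioo_split[of 0 a b] by (simp add: cumul_def)
  next
    case 5 then show ?thesis using measure_Ioo_split[of a 0 b] by (simp add: cumul_def)
  next
    case 6 then show ?thesis using measure_Ioo_split[of a b 0] by (simp add: cumul_def)
  qed (simp_all add: cumul_def)
qed

lemma measure_Icc: "measure \<mu> {a..b} = measure \<mu> {a<..<b}" if "a \<le> b"
proof (cases "a = b")
  case False
  have "measure \<mu> {a..b} = measure \<mu> {a<..b} + measure \<mu> {a}"
    by (rule measure_disjoint_Un[of _ _ a b]) (use that in auto)
  moreover have "measure \<mu> {a<..b} = measure \<mu> {a<..<b} + measure \<mu> {b}"
    by (rule measure_disjoint_Un[of _ _ a b]) (use that False in auto)
  ultimately show ?thesis by (simp add: measure_singleton)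
qed (simp add: measure_singleton)

lemma measure_Ico: "measure \<mu> {a..<b} = measure \<mu> {a<..<b}"
proof (cases "a < b")
  case True
  have "measure \<mu> {a..<b} = measure \<mu> {a<..<b} + measure \<mu> {a}"
    by (rule measure_disjoint_Un[of _ _ a b]) (use True in auto)
  then show ?thesis by (simp add: measure_singleton)
qed simp

lemma emeasure_Icc_eq: "emeasure \<mu> {a..b} = ennreal (measure \<mu> {a..b})"
  by (rule emeasure_eq_measure_bdd[of _ a b]) auto

lemma cumul_0: "cumul \<mu> 0 = 0" by (simp add: cumul_def)

lemma mono_cumul: "a \<le> b \<Longrightarrow> cumul \<mu> a \<le> cumul \<mu> b"
  using cumul_diff[of a b] measure_nonneg[of \<mu> "{a<..<b}"] by linarith

text \<open>For a finite measure, continuity of the distribution function at t is the absence of an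
  atom at t. A clock has infinite mass, so it is first cut to a window around t, on which
  \<open>cumul \<mu>\<close> and the \<open>cdf\<close> of the cut measure differ by a
  constant.\<close>

lemma isCont_cumul: "isCont (cumul \<mu>) t"
proof -
  define n where "n = \<bar>t\<bar> + 1"
  define N where "N = density \<mu> (indicator {-n..n})"
  have N: "emeasure N A = emeasure \<mu> (A \<inter> {-n..n})" if "A \<in> sets borel" for A
    unfolding N_def using that
    by (subst emeasure_density) (auto simp: sets_eq indicator_inter_arith[symmetric] Int_commute 
        intro!: nn_integral_indicator)
  have "finite_measure N"
    using finite_Icc[of "-n" n] N[of UNIV] by (intro finite_measureI) (simp add: N_def space_eq)
  then interpret N: finite_borel_measure N
    by (intro finite_borel_measure.intro finite_borel_measure_axioms.intro) (simp_all add: N_def sets_eq)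
  have "measure N {t} = 0"
    using N[of "{t}"] diffuse[of t] by (simp add: measure_def n_def split: abs_split)
  then have c: "isCont (cdf N) t" by (simp add: N.isCont_cdf)
  have eq: "cumul \<mu> s = cdf N s + cumul \<mu> (-n)" if "s \<in> {-n<..<n}" for s
  proof -
    have "{..s} \<inter> {-n..n} = {-n..s}" using that by auto
    then have "cdf N s = measure \<mu> {-n..s}"
      using N[of "{..s}"] unfolding cdf_def measure_def by (simp only: borel_closed closed_atMost)
    with cumul_diff[of "-n" s] measure_Icc[of "-n" s] that show ?thesis by simp
  qed
  have "isCont (\<lambda>s. cdf N s + cumul \<mu> (-n)) t" using c by simp
  moreover have "eventually (\<lambda>s. s \<in> {-n<..<n}) (nhds t)"
    by (rule eventually_nhds_in_open) (auto simp: n_def split: abs_split)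
  then have "eventually (\<lambda>s. cumul \<mu> s = cdf N s + cumul \<mu> (-n)) (nhds t)"
    by eventually_elim (rule eq)
  ultimately show ?thesis by (subst isCont_cong) auto
qed

lemma cumul_unbounded_above: "\<exists>t. r < cumul \<mu> t"
proof -
  have "(SUP n. emeasure \<mu> {0<..<real n}) = emeasure \<mu> (\<Union>n. {0<..<real n})"
    by (rule SUP_emeasure_incseq) (auto simp: sets_eq incseq_def)
  also have "(\<Union>n. {0<..<real n}) = {0<..}"
    using reals_Archimedean2 by auto
  finally have "ennreal \<bar>r\<bar> < (SUP n. emeasure \<mu> {0<..<real n})" unfolding infinite_right by (simp only: infinity_ennreal_def ennreal_less_top)
  then obtain n where n: "ennreal \<bar>r\<bar> < emeasure \<mu> {0<..<real n}"
    unfolding less_SUP_iff by auto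
  have "emeasure \<mu> {0<..<real n} = ennreal (measure \<mu> {0<..<real n})"
    by (rule emeasure_eq_measure_bdd[of _ 0 "real n"]) auto
  with n have "\<bar>r\<bar> < measure \<mu> {0<..<real n}" by (simp add: ennreal_less_iff)
  then have "r < cumul \<mu> (real n)" by (simp add: cumul_def)
  then show ?thesis ..
qed

lemma cumul_unbounded_below: "\<exists>t. cumul \<mu> t < r"
proof -
  have "(SUP n. emeasure \<mu> {-real n<..<0}) = emeasure \<mu> (\<Union>n. {-real n<..<0})"
    by (rule SUP_emeasure_incseq) (auto simp: sets_eq incseq_def)
  also have "(\<Union>n. {-real n<..<0}) = {..<0}"
  proof -
    have "\<exists>n. - real n < x" for x using reals_Archimedean2[of "-x"] by (auto simp: minus_less_iff)
    then show ?thesis by auto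
  qed
  finally have "ennreal \<bar>r\<bar> < (SUP n. emeasure \<mu> {-real n<..<0})" unfolding infinite_left by (simp only: infinity_ennreal_def ennreal_less_top)
  then obtain n where n: "ennreal \<bar>r\<bar> < emeasure \<mu> {-real n<..<0}"
    unfolding less_SUP_iff by auto
  have "emeasure \<mu> {-real n<..<0} = ennreal (measure \<mu> {-real n<..<0})"
    by (rule emeasure_eq_measure_bdd[of _ "-real n" 0]) auto
  with n have "\<bar>r\<bar> < measure \<mu> {-real n<..<0}" by (simp add: ennreal_less_iff)
  then have "cumul \<mu> (- real n) < r" by (simp add: cumul_def)
  then show ?thesis ..
qed

text \<open>A Galois connection. Left to right is monotonicity; right to left uses continuity, which
  makes the set of times above level r open, so that its infimum is not attained.\<close>

lemma cumul_inv_less_iff: "cumul_inv \<mu> r < t \<longleftrightarrow> r < cumul \<mu> t"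
proof
  let ?S = "{t. r < cumul \<mu> t}"
  have ne: "?S \<noteq> {}" using cumul_unbounded_above by auto
  obtain b where b: "cumul \<mu> b < r" using cumul_unbounded_below by blast
  have bdd: "bdd_below ?S"
  proof (rule bdd_belowI[of _ b])
    fix t assume "t \<in> ?S"
    with b mono_cumul[of t b] show "b \<le> t" by (cases "b \<le> t") auto
  qed
  {
    assume "cumul_inv \<mu> r < t"
    then obtain s where "s \<in> ?S" "s < t"
      unfolding cumul_inv_def using cInf_lessD[OF ne] by blast
    with mono_cumul[of s t] show "r < cumul \<mu> t" by auto
  }
  assume "r < cumul \<mu> t"
  have "eventually (\<lambda>s. r < cumul \<mu> s) (at t)"
    using isCont_cumul[of t] \<open>r < cumul \<mu> t\<close> unfolding isCont_def by (rule order_tendstoD)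
  then obtain d where d: "0 < d" "\<And>s. s \<noteq> t \<Longrightarrow> dist s t < d \<Longrightarrow> r < cumul \<mu> s"
    unfolding eventually_at by auto
  have "r < cumul \<mu> (t - d/2)" using d by (intro d(2)) (auto simp: dist_real_def)
  then have "cumul_inv \<mu> r \<le> t - d/2" unfolding cumul_inv_def
    by (intro cInf_lower bdd) simp
  with d(1) show "cumul_inv \<mu> r < t" by simp
qed

lemma le_cumul_inv_iff: "t \<le> cumul_inv \<mu> r \<longleftrightarrow> cumul \<mu> t \<le> r"
  using cumul_inv_less_iff[of r t] by linarith

lemma cumul_cumul_inv: "cumul \<mu> (cumul_inv \<mu> r) = r"
proof (rule antisym)
  show "cumul \<mu> (cumul_inv \<mu> r) \<le> r" using le_cumul_inv_iff by blast
  show "r \<le> cumul \<mu> (cumul_inv \<mu> r)"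
  proof (rule ccontr)
    let ?t = "cumul_inv \<mu> r"
    assume "\<not> ?thesis"
    then have "eventually (\<lambda>s. cumul \<mu> s < r) (at ?t)"
      using isCont_cumul[of ?t] unfolding isCont_def by (intro order_tendstoD) auto
    then obtain d where d: "0 < d" "\<And>s. s \<noteq> ?t \<Longrightarrow> dist s ?t < d \<Longrightarrow> cumul \<mu> s < r"
      unfolding eventually_at by auto
    have "cumul \<mu> (?t + d/2) < r" using d by (intro d(2)) (auto simp: dist_real_def)
    with cumul_inv_less_iff[of r "?t + d/2"] d(1) show False by simp
  qed
qed

lemma mono_cumul_inv: "mono (cumul_inv \<mu>)"
proof
  fix r s :: real assume "r \<le> s"
  have "cumul \<mu> (cumul_inv \<mu> r) \<le> s" by (simp add: cumul_cumul_inv \<open>r \<le> s\<close>)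
  then show "cumul_inv \<mu> r \<le> cumul_inv \<mu> s" by (simp add: le_cumul_inv_iff)
qed

lemma cumul_inv_measurable [measurable]: "cumul_inv \<mu> \<in> borel_measurable borel"
  using mono_cumul_inv by (rule borel_measurable_mono)

lemma cumul_measurable [measurable]: "cumul \<mu> \<in> borel_measurable borel"
  by (rule borel_measurable_mono) (auto intro!: monoI mono_cumul)

text \<open>By the Galois connection the preimage of \<open>{a..<b}\<close> is exactly
  \<open>{cumul \<mu> a..<cumul \<mu> b}\<close>, so half-open intervals of this orientation match.
  The diffuse measure is Lebesgue measure run through its own inverse clock.\<close>

lemma eq_distr_cumul_inv: "\<mu> = distr lborel borel (cumul_inv \<mu>)"
proof (rule measure_eqI_generator_eq)
  let ?E = "range (\<lambda>(a, b). {a..<b::real})"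
  show "Int_stable ?E" by (auto simp: Int_stable_def)
  show "?E \<subseteq> Pow UNIV" by simp
  show "sets \<mu> = sigma_sets UNIV ?E"
    unfolding sets_eq borel_eq_atLeastLessThan by (simp add: image_def case_prod_unfold)
  then show "sets (distr lborel borel (cumul_inv \<mu>)) = sigma_sets UNIV ?E"
    using sets_eq by simp
  show "range (\<lambda>n. {-real n..<real n}) \<subseteq> ?E" by auto
  show "(\<Union>n. {-real n..<real n}) = UNIV"
  proof -
    have "\<exists>n. - real n \<le> x \<and> x < real n" for x
    proof -
      obtain n where "\<bar>x\<bar> < real n" using reals_Archimedean2 by blast
      then show ?thesis by (intro exI[of _ n]) linarith
    qed
    then show ?thesis by auto
  qed
  show "emeasure \<mu> {-real n..<real n} \<noteq> \<infinity>" for n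
    by (rule finite_subset_Icc[of _ "-real n" "real n"]) auto
  fix X assume "X \<in> ?E"
  then obtain a b where X: "X = {a..<b}" by auto
  show "emeasure \<mu> X = emeasure (distr lborel borel (cumul_inv \<mu>)) X"
  proof (cases "a \<le> b")
    case True
    have "cumul_inv \<mu> -` {a..<b} = {cumul \<mu> a..<cumul \<mu> b}"
      by (auto simp: le_cumul_inv_iff cumul_inv_less_iff)
    then have "emeasure (distr lborel borel (cumul_inv \<mu>)) X = ennreal (cumul \<mu> b - cumul \<mu> a)"
      using mono_cumul[OF True] by (simp add: X emeasure_distr)
    also have "\<dots> = ennreal (measure \<mu> {a..<b})"
      by (simp add: cumul_diff[OF True] measure_Ico)
    also have "\<dots> = emeasure \<mu> {a..<b}"
      by (rule emeasure_eq_measure_bdd[of _ a b, symmetric]) auto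
    finally show ?thesis by (simp add: X)
  qed (simp add: X)
qed

text \<open>The times above a level form an open ray, so rationals determine its left end. This
  countable infimum is what makes the inverse local time measurable in the path.\<close>

lemma cumul_inv_INF_rat:
  "(INF q\<in>\<rat>. if r < cumul \<mu> q then ereal q else \<infinity>) = ereal (cumul_inv \<mu> r)"
proof (rule antisym)
  show "ereal (cumul_inv \<mu> r) \<le> (INF q\<in>\<rat>. if r < cumul \<mu> q then ereal q else \<infinity>)"
    by (rule INF_greatest) (auto simp: cumul_inv_less_iff[symmetric])
  show "(INF q\<in>\<rat>. if r < cumul \<mu> q then ereal q else \<infinity>) \<le> ereal (cumul_inv \<mu> r)"
  proof (rule ereal_le_epsilon2)
    fix e :: real assume "0 < e"
    then obtain q where q: "q \<in> \<rat>" "cumul_inv \<mu> r < q" "q < cumul_inv \<mu> r + e"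
      using Rats_dense_in_real[of "cumul_inv \<mu> r" "cumul_inv \<mu> r + e"] by auto
    have "(INF q\<in>\<rat>. if r < cumul \<mu> q then ereal q else \<infinity>) \<le> (if r < cumul \<mu> q then ereal q else \<infinity>)"
      by (rule INF_lower) (rule q)
    also have "\<dots> = ereal q" using q(2) by (simp add: cumul_inv_less_iff)
    also have "\<dots> \<le> ereal (cumul_inv \<mu> r) + ereal e" using q(3) by simp
    finally show "(INF q\<in>\<rat>. if r < cumul \<mu> q then ereal q else \<infinity>) \<le> ereal (cumul_inv \<mu> r) + ereal e" .
  qed
qed

text \<open>Among the times with \<open>cumul \<mu> t = r\<close> the inverse is the largest, and it
  meets the constraint \<open>0 \<le> t\<close> because r is nonnegative. For negative levels the
  inverse is strictly negative, which fits the constraint \<open>t < 0\<close> there.\<close>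

lemma Sup_level_nonneg:
  assumes "0 \<le> r"
  shows "Sup (ereal ` {t. 0 \<le> t \<and> emeasure \<mu> {0..t} = ennreal r}) = ereal (cumul_inv \<mu> r)"
proof -
  have *: "emeasure \<mu> {0..t} = ennreal r \<longleftrightarrow> cumul \<mu> t = r" if "0 \<le> t" for t
    using cumul_diff[OF that] that assms by (simp add: emeasure_Icc_eq measure_Icc cumul_0)
  show ?thesis
  proof (rule Sup_eqI)
    have "0 \<le> cumul_inv \<mu> r" by (simp add: le_cumul_inv_iff cumul_0 assms)
    then have "ereal (cumul_inv \<mu> r) \<in> ereal ` {t. 0 \<le> t \<and> emeasure \<mu> {0..t} = ennreal r}"
      using cumul_cumul_inv by (auto simp: *)
    then show "\<And>y. (\<And>z. z \<in> ereal ` {t. 0 \<le> t \<and> emeasure \<mu> {0..t} = ennreal r} \<Longrightarrow> z \<le> y)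
        \<Longrightarrow> ereal (cumul_inv \<mu> r) \<le> y" by blast
  qed (auto simp: * le_cumul_inv_iff)
qed

lemma Sup_level_neg:
  assumes "r < 0"
  shows "Sup (ereal ` {t. t < 0 \<and> emeasure \<mu> {t..0} = ennreal (- r)}) = ereal (cumul_inv \<mu> r)"
proof -
  have *: "emeasure \<mu> {t..0} = ennreal (- r) \<longleftrightarrow> cumul \<mu> t = r" if "t < 0" for t
    using cumul_diff[of t 0] that assms by (auto simp: emeasure_Icc_eq measure_Icc cumul_0)
  show ?thesis
  proof (rule Sup_eqI)
    have "cumul_inv \<mu> r < 0" by (simp add: cumul_inv_less_iff cumul_0 assms)
    then have "ereal (cumul_inv \<mu> r) \<in> ereal ` {t. t < 0 \<and> emeasure \<mu> {t..0} = ennreal (- r)}"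
      using cumul_cumul_inv by (auto simp: *)
    then show "\<And>y. (\<And>z. z \<in> ereal ` {t. t < 0 \<and> emeasure \<mu> {t..0} = ennreal (- r)} \<Longrightarrow> z \<le> y)
        \<Longrightarrow> ereal (cumul_inv \<mu> r) \<le> y" by blast
  qed (auto simp: * le_cumul_inv_iff)
qed

lemma nn_integral_cumul_inv:
  assumes [measurable]: "f \<in> borel_measurable borel"
  shows "(\<integral>\<^sup>+s. f s \<partial>\<mu>) = (\<integral>\<^sup>+u. f (cumul_inv \<mu> u) \<partial>lborel)"
  by (subst eq_distr_cumul_inv) (simp add: nn_integral_distr)

text \<open>In the clock coordinate moving each point by mass r is a translation, and Lebesgue
  measure is invariant under it. The arguments of \<psi> are source and target: the same transport
  is integrated once over sources and once over targets.\<close>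

lemma nn_integral_transport:
  assumes [measurable]: "(\<lambda>(s, t). \<psi> s t) \<in> borel_measurable (borel \<Otimes>\<^sub>M borel)"
  shows "(\<integral>\<^sup>+s. \<psi> s (cumul_inv \<mu> (cumul \<mu> s + r)) \<partial>\<mu>) =
         (\<integral>\<^sup>+s. \<psi> (cumul_inv \<mu> (cumul \<mu> s - r)) s \<partial>\<mu>)"
proof -
  have "(\<integral>\<^sup>+s. \<psi> s (cumul_inv \<mu> (cumul \<mu> s + r)) \<partial>\<mu>) =
      (\<integral>\<^sup>+u. \<psi> (cumul_inv \<mu> u) (cumul_inv \<mu> (u + r)) \<partial>lborel)"
    by (subst nn_integral_cumul_inv) (simp_all add: cumul_cumul_inv)
  also have "\<dots> = (\<integral>\<^sup>+u. \<psi> (cumul_inv \<mu> (-r + 1 * u)) (cumul_inv \<mu> (-r + 1 * u + r)) \<partial>lborel)"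
    by (subst nn_integral_real_affine[where c=1 and t="-r"]) simp_all
  also have "\<dots> = (\<integral>\<^sup>+s. \<psi> (cumul_inv \<mu> (cumul \<mu> s - r)) s \<partial>\<mu>)"
    by (subst nn_integral_cumul_inv) (simp_all add: cumul_cumul_inv)
  finally show ?thesis .
qed

text \<open>Seen from s the count is \<open>cumul \<mu> (s + t) - cumul \<mu> s\<close>, so level r
  counted from s is level \<open>cumul \<mu> s + r\<close> counted from 0.\<close>

lemma cumul_inv_shift:
  assumes "sets \<nu> = sets borel"
    and eq: "\<And>a b. emeasure \<nu> {a - s<..<b - s} = emeasure \<mu> {a<..<b}"
  shows "cumul_inv \<nu> r = cumul_inv \<mu> (cumul \<mu> s + r) - s"
proof -
  have eq': "measure \<nu> {a<..<b} = measure \<mu> {s + a<..<s + b}" for a b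
    using eq[of "s + a" "s + b"] by (simp add: measure_def)
  have "cumul \<nu> t = cumul \<mu> (s + t) - cumul \<mu> s" for t
    using cumul_diff[of s "s+t"] cumul_diff[of "s+t" s] unfolding cumul_def[of \<nu>] eq'
    by (cases "0 \<le> t") auto
  then have "r < cumul \<nu> t \<longleftrightarrow> cumul_inv \<mu> (cumul \<mu> s + r) - s < t" for t
    using cumul_inv_less_iff[of "cumul \<mu> s + r" "s + t"] by auto
  then have "{t. r < cumul \<nu> t} = {cumul_inv \<mu> (cumul \<mu> s + r) - s<..}" by auto
  then show ?thesis by (simp add: cumul_inv_def[of \<nu>])
qed

end

subsection \<open>Path space\<close>

text \<open>Changes the starting point: the image of P0 under \<open>lift x\<close> is
  \<open>started_at P0 x\<close>.\<close>

definition lift :: "real \<Rightarrow> path \<Rightarrow> path" where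
  "lift x \<omega> = (\<lambda>t. \<omega> t + x)"

text \<open>The increment path seen from time s; for a fixed s it is again Brownian.\<close>

definition pinned :: "real \<Rightarrow> path \<Rightarrow> path" where
  "pinned s \<omega> = (\<lambda>t. \<omega> (s + t) - \<omega> s)"

lemma space_Omega: "space \<Omega> = {\<omega>. continuous_on UNIV \<omega>}"
  by (simp add: \<Omega>_def space_restrict_space space_PiM)

lemma measurable_OmegaI:
  assumes "\<And>z. z \<in> space M \<Longrightarrow> continuous_on UNIV (f z)"
    and "\<And>t. (\<lambda>z. f z t) \<in> borel_measurable M"
  shows "f \<in> M \<rightarrow>\<^sub>M \<Omega>"
  unfolding \<Omega>_def
proof (rule measurable_restrict_space2)
  show "f \<in> M \<rightarrow>\<^sub>M PiM UNIV (\<lambda>_. borel)"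
    using assms(2) by (intro measurable_PiM_single') (auto simp: space_PiM)
qed (use assms(1) in auto)

lemma measurable_coordinate [measurable]: "(\<lambda>\<omega>. \<omega> t) \<in> borel_measurable \<Omega>"
  unfolding \<Omega>_def by (intro measurable_restrict_space1) measurable

text \<open>By path continuity, evaluation at a random time is the limit of evaluations at the time
  rounded down to a grid of mesh 1/(n+1). A rounded time has countably many values, which reduces
  the claim to fixed coordinates.\<close>

lemma measurable_coordinate_at:
  assumes f: "f \<in> M \<rightarrow>\<^sub>M \<Omega>" and g [measurable]: "g \<in> borel_measurable M"
  shows "(\<lambda>z. f z (g z :: real)) \<in> borel_measurable M"
proof (rule borel_measurable_LIMSEQ_real)
  let ?u = "\<lambda>n z. real_of_int \<lfloor>real (Suc n) * g z\<rfloor> / real (Suc n)"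
  show "(\<lambda>n. f z (?u n z)) \<longlonglongrightarrow> f z (g z)" if "z \<in> space M" for z
  proof -
    have "(\<lambda>n. ?u n z) \<longlonglongrightarrow> g z"
    proof (rule tendsto_sandwich[where f="\<lambda>n. g z - 1 / real (Suc n)" and h="\<lambda>_. g z"])
      show "\<forall>\<^sub>F n in sequentially. g z - 1 / real (Suc n) \<le> ?u n z"
      proof (intro always_eventually allI)
        fix n
        have "(real (Suc n) * g z - 1) / real (Suc n) \<le> ?u n z"
          by (intro divide_right_mono) linarith+
        then show "g z - 1 / real (Suc n) \<le> ?u n z" by (simp add: diff_divide_distrib del: of_nat_Suc)
      qed
      show "\<forall>\<^sub>F n in sequentially. ?u n z \<le> g z"
      proof (intro always_eventually allI)
        fix n
        have "?u n z \<le> (real (Suc n) * g z) / real (Suc n)"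
          by (intro divide_right_mono) linarith+
        then show "?u n z \<le> g z" by (simp del: of_nat_Suc)
      qed
      show "(\<lambda>n. g z - 1 / real (Suc n)) \<longlonglongrightarrow> g z"
        using tendsto_diff[OF tendsto_const[of "g z"] LIMSEQ_inverse_real_of_nat]
        by (simp add: inverse_eq_divide)
    qed simp
    moreover have "isCont (f z) (g z)"
      using measurable_space[OF f that] by (simp add: space_Omega continuous_on_eq_continuous_at)
    ultimately show ?thesis using isCont_tendsto_compose by blast
  qed
  show "(\<lambda>z. f z (?u n z)) \<in> borel_measurable M" for n
  proof (rule measurable_compose_countable[of "\<lambda>k z. f z (real_of_int k / real (Suc n))"
        M borel "\<lambda>z. \<lfloor>real (Suc n) * g z\<rfloor>"])
    show "(\<lambda>z. f z (real_of_int k / real (Suc n))) \<in> borel_measurable M" for k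
      by (rule measurable_compose[OF f measurable_coordinate])
  qed simp
qed

lemma measurable_shift [measurable (raw)]:
  assumes f: "f \<in> M \<rightarrow>\<^sub>M \<Omega>" and g [measurable]: "g \<in> borel_measurable M"
  shows "(\<lambda>z. shift (g z) (f z)) \<in> M \<rightarrow>\<^sub>M \<Omega>"
proof (rule measurable_OmegaI)
  fix z assume "z \<in> space M"
  then have "continuous_on UNIV (f z)" using measurable_space[OF f] by (simp add: space_Omega)
  then show "continuous_on UNIV (shift (g z) (f z))"
    unfolding shift_def by (rule continuous_on_compose2) (auto intro!: continuous_intros)
qed (simp add: shift_def measurable_coordinate_at[OF f])

lemma measurable_lift [measurable (raw)]:
  assumes f: "f \<in> M \<rightarrow>\<^sub>M \<Omega>" and [measurable]: "g \<in> borel_measurable M"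
  shows "(\<lambda>z. lift (g z) (f z)) \<in> M \<rightarrow>\<^sub>M \<Omega>"
proof (rule measurable_OmegaI)
  fix z assume "z \<in> space M"
  then have "continuous_on UNIV (f z)" using measurable_space[OF f] by (simp add: space_Omega)
  then show "continuous_on UNIV (lift (g z) (f z))"
    unfolding lift_def by (auto intro!: continuous_intros)
next
  fix t show "(\<lambda>z. lift (g z) (f z) t) \<in> borel_measurable M"
    unfolding lift_def using measurable_coordinate_at[OF f] by measurable
qed

lemma pinned_eq: "pinned s \<omega> = lift (- \<omega> s) (shift s \<omega>)"
  by (simp add: pinned_def lift_def shift_def)

lemma measurable_pinned [measurable (raw)]:
  assumes f [measurable]: "f \<in> M \<rightarrow>\<^sub>M \<Omega>" and g [measurable]: "g \<in> borel_measurable M"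
  shows "(\<lambda>z. pinned (g z) (f z)) \<in> M \<rightarrow>\<^sub>M \<Omega>"
  unfolding pinned_eq using measurable_coordinate_at[OF f g] by measurable

lemma shift_shift: "shift s (shift t \<omega>) = shift (t + s) \<omega>"
  by (simp add: shift_def add.assoc)

text \<open>The source of the shift invariance of \<open>Q\<close>: a time shift only moves the
  offset by \<open>\<omega> s\<close> and pins the path, and Lebesgue measure on the offset absorbs
  the displacement.\<close>

lemma shift_lift: "shift s (lift x \<omega>) = lift (x + \<omega> s) (pinned s \<omega>)"
  by (simp add: shift_def lift_def pinned_def algebra_simps)

lemma shift_in_Omega: "\<omega> \<in> space \<Omega> \<Longrightarrow> shift t \<omega> \<in> space \<Omega>"
  using measurable_space[OF measurable_shift[of "\<lambda>z. z" \<Omega> "\<lambda>_. t"]] by simp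

lemma lift_in_Omega: "\<omega> \<in> space \<Omega> \<Longrightarrow> lift t \<omega> \<in> space \<Omega>"
  using measurable_space[OF measurable_lift[of "\<lambda>z. z" \<Omega> "\<lambda>_. t"]] by simp

subsection \<open>Uniqueness of the Brownian law\<close>

text \<open>Conditions on path values, written in terms of consecutive increments d. The partial sum
  up to j telescopes to X(t j) - X(t 0); subtracting the partial sum up to the index where t
  vanishes replaces the reference time t 0 by 0, where the path is 0.\<close>

definition increments_event ::
    "real set \<Rightarrow> (real \<Rightarrow> real set) \<Rightarrow> nat \<Rightarrow> (nat \<Rightarrow> real) \<Rightarrow> (nat \<Rightarrow> real) set" where
  "increments_event J A n t =
     {d \<in> space (PiM {..<n} (\<lambda>_. borel)). \<forall>j\<le>n. t j \<in> J \<longrightarrow>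
        (\<Sum>i<j. d i) - (\<Sum>i<(LEAST i. t i = 0). d i) \<in> A (t j)}"

text \<open>The right-hand side mentions neither M nor X, so any two Brownian motions give a
  cylinder the same probability. Time 0 lies on the grid because path values are recovered from
  increments and the value at 0.\<close>

lemma BM_cylinder:
  assumes BM: "two_sided_standard_BM M X"
    and t: "strict_mono_on {..n} t" "J \<subseteq> t ` {..n}" "0 \<in> t ` {..n}" "0 < n"
    and A: "\<And>i. i \<in> J \<Longrightarrow> A i \<in> sets borel"
  shows "emeasure M {\<omega> \<in> space M. \<forall>i\<in>J. X \<omega> i \<in> A i} =
    emeasure (PiM {..<n} (\<lambda>i. density lborel (normal_density 0 (sqrt (t (Suc i) - t i)))))
      (increments_event J A n t)"
proof -
  interpret prob_space M using BM by (simp add: two_sided_standard_BM_def)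
  have X [measurable]: "X \<in> M \<rightarrow>\<^sub>M \<Omega>" using BM by (simp add: two_sided_standard_BM_def)
  have Xt [measurable]: "(\<lambda>\<omega>. X \<omega> s) \<in> borel_measurable M" for s
    by (rule measurable_coordinate_at) simp_all
  define i0 where "i0 = (LEAST i. t i = 0)"
  obtain i1 where i1: "i1 \<le> n" "t i1 = 0" using t(3) by force
  have ti0: "t i0 = 0" unfolding i0_def by (rule LeastI[of _ i1]) (rule i1)
  have i0: "i0 \<le> n" using i1 unfolding i0_def by (meson Least_le order_trans)
  define D where "D \<omega> = (\<lambda>i\<in>{..<n}. X \<omega> (t (Suc i)) - X \<omega> (t i))" for \<omega>
  have D [measurable]: "D \<in> M \<rightarrow>\<^sub>M PiM {..<n} (\<lambda>_. borel)"
    unfolding D_def by measurable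
  define E where "E = increments_event J A n t"
  have E [measurable]: "E \<in> sets (PiM {..<n} (\<lambda>_. borel))"
  proof -
    have 1: "(\<lambda>d. \<Sum>i<j. d i) \<in> borel_measurable (PiM {..<n} (\<lambda>_. borel :: real measure))" if "j \<le> n" for j
      using that by (intro borel_measurable_sum measurable_component_singleton) auto
    have 2: "{d \<in> space (PiM {..<n} (\<lambda>_. borel)). (\<Sum>i<j. d i) - (\<Sum>i<i0. d i) \<in> A (t j)}
        \<in> sets (PiM {..<n} (\<lambda>_. borel))" if "j \<le> n" "t j \<in> J" for j
      using A[OF that(2)] 1[OF that(1)] 1[OF i0] by measurable
    have "E = {d \<in> space (PiM {..<n} (\<lambda>_. borel)). \<forall>j\<in>{j. j \<le> n \<and> t j \<in> J}.
        (\<Sum>i<j. d i) - (\<Sum>i<i0. d i) \<in> A (t j)}"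
      by (auto simp: E_def increments_event_def i0_def)
    also have "\<dots> \<in> sets (PiM {..<n} (\<lambda>_. borel))"
      by (rule sets.sets_Collect_finite_All, rule 2) auto
    finally show ?thesis .
  qed
  have "distr M (PiM {..<n} (\<lambda>_. borel)) D =
      PiM {..<n} (\<lambda>i. distr M borel (\<lambda>\<omega>. X \<omega> (t (Suc i)) - X \<omega> (t i)))"
    unfolding D_def
    by (rule indep_vars_iff_distr_eq_PiM[THEN iffD1])
       (use BM t in \<open>auto simp: two_sided_standard_BM_def\<close>)
  also have "\<dots> = PiM {..<n} (\<lambda>i. density lborel (normal_density 0 (sqrt (t (Suc i) - t i))))"
  proof (rule PiM_cong)
    fix i assume "i \<in> {..<n}"
    then have "t i < t (Suc i)" using t(1) by (intro strict_mono_onD[OF t(1)]) auto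
    then have "distributed M lborel (\<lambda>\<omega>. X \<omega> (t (Suc i)) - X \<omega> (t i)) (normal_density 0 (sqrt (t (Suc i) - t i)))"
      using BM by (simp add: two_sided_standard_BM_def)
    then have "distr M lborel (\<lambda>\<omega>. X \<omega> (t (Suc i)) - X \<omega> (t i)) = density lborel (normal_density 0 (sqrt (t (Suc i) - t i)))"
      by (simp add: distributed_def)
    then show "distr M borel (\<lambda>\<omega>. X \<omega> (t (Suc i)) - X \<omega> (t i)) = density lborel (normal_density 0 (sqrt (t (Suc i) - t i)))"
      using distr_cong[of M M borel lborel "\<lambda>\<omega>. X \<omega> (t (Suc i)) - X \<omega> (t i)" "\<lambda>\<omega>. X \<omega> (t (Suc i)) - X \<omega> (t i)"]
      by simp
  qed simp
  finally have law: "distr M (PiM {..<n} (\<lambda>_. borel)) D = \<dots>" .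
  have "emeasure M {\<omega> \<in> space M. \<forall>i\<in>J. X \<omega> i \<in> A i} = emeasure M (D -` E \<inter> space M)"
  proof (rule emeasure_eq_AE)
    have "AE \<omega> in M. X \<omega> 0 = 0" using BM by (simp add: two_sided_standard_BM_def)
    then show "AE \<omega> in M. \<omega> \<in> {\<omega> \<in> space M. \<forall>i\<in>J. X \<omega> i \<in> A i} \<longleftrightarrow> \<omega> \<in> D -` E \<inter> space M"
    proof (eventually_elim, goal_cases)
      case (1 \<omega>)
      have sm: "(\<Sum>i<j. D \<omega> i) = X \<omega> (t j) - X \<omega> (t 0)" if "j \<le> n" for j
      proof -
        have "(\<Sum>i<j. D \<omega> i) = (\<Sum>i<j. X \<omega> (t (Suc i)) - X \<omega> (t i))"
          using that by (intro sum.cong) (auto simp: D_def)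
        then show ?thesis by (simp add: sum_lessThan_telescope[of "\<lambda>i. X \<omega> (t i)"])
      qed
      have "D \<omega> \<in> space (PiM {..<n} (\<lambda>_. borel))" by (auto simp: D_def space_PiM)
      then have "D \<omega> \<in> E \<longleftrightarrow> (\<forall>j\<le>n. t j \<in> J \<longrightarrow> X \<omega> (t j) \<in> A (t j))"
        using 1 by (simp add: E_def increments_event_def i0_def[symmetric] sm[OF i0] sm ti0)
      also have "\<dots> \<longleftrightarrow> (\<forall>i\<in>J. X \<omega> i \<in> A i)" using t(2) by (auto 4 3)
      finally show ?case by auto
    qed
    have "finite J" using finite_subset[OF t(2)] by simp
    then show "{\<omega> \<in> space M. \<forall>i\<in>J. X \<omega> i \<in> A i} \<in> sets M"
      using A by (intro sets.sets_Collect_finite_All) auto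
  qed simp
  also have "\<dots> = emeasure (distr M (PiM {..<n} (\<lambda>_. borel)) D) E"
    by (simp add: emeasure_distr)
  finally show ?thesis unfolding law E_def .
qed

text \<open>Cylinders determine a finite measure on the full product space; as both processes take
  values in \<Omega>, the identity passes to its trace \<sigma>-algebra.\<close>

lemma BM_law_unique:
  assumes X: "two_sided_standard_BM M X" and Y: "two_sided_standard_BM N Y"
  shows "distr M \<Omega> X = distr N \<Omega> Y"
proof -
  interpret M: prob_space M using X by (simp add: two_sided_standard_BM_def)
  have X' [measurable]: "X \<in> M \<rightarrow>\<^sub>M \<Omega>" and Y' [measurable]: "Y \<in> N \<rightarrow>\<^sub>M \<Omega>"
    using X Y by (simp_all add: two_sided_standard_BM_def)
  let ?P = "PiM UNIV (\<lambda>_. borel) :: path measure"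
  have sub: "(\<lambda>\<omega>. \<omega>) \<in> \<Omega> \<rightarrow>\<^sub>M ?P"
    unfolding \<Omega>_def by (rule measurable_restrict_space1) simp
  have XP [measurable]: "X \<in> M \<rightarrow>\<^sub>M ?P" and YP [measurable]: "Y \<in> N \<rightarrow>\<^sub>M ?P"
    using measurable_compose[OF _ sub] by measurable
  have eqP: "distr M ?P X = distr N ?P Y"
  proof (rule measure_eqI_PiM_infinite)
    show "finite_measure (distr M ?P X)"
      by (intro prob_space.finite_measure M.prob_space_distr) simp
    fix A :: "real \<Rightarrow> real set" and J :: "real set" assume J: "finite J" "\<And>i. i \<in> J \<Longrightarrow> A i \<in> sets borel"
    \<comment> \<open>0 anchors the increments at a known value, and 1 guarantees a second grid
      point, hence at least one increment.\<close>
    define K where "K = insert 0 (insert 1 J)"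
    define n where "n = card K - 1"
    define t where "t i = sorted_list_of_set K ! i" for i
    have K: "finite K" "card K = Suc n"
    proof -
      show "finite K" using J(1) by (simp add: K_def)
      then have "0 < card K" by (auto simp: card_gt_0_iff K_def)
      then show "card K = Suc n" by (simp add: n_def)
    qed
    have tK: "t ` {..n} = K"
    proof -
      have "t ` {..n} = (!) (sorted_list_of_set K) ` {0..<length (sorted_list_of_set K)}"
        using K by (auto simp: t_def lessThan_Suc_atMost[symmetric] atLeast0LessThan)
      also have "\<dots> = K" using nth_image[of _ "sorted_list_of_set K"] K(1) by simp
      finally show ?thesis .
    qed
    have n: "0 < n"
    proof (rule ccontr)
      assume "\<not> 0 < n"
      then have "card K = 1" using K by simp
      then show False using card_1_singletonE[of K] by (auto simp: K_def)
    qed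
    have t: "strict_mono_on {..n} t"
    proof (rule strict_mono_onI)
      fix i j assume "i \<in> {..n}" "j \<in> {..n}" "i < j"
      then show "t i < t j" unfolding t_def
        using K by (intro sorted_wrt_nth_less[OF strict_sorted_list_of_set]) auto
    qed
    have cyl: "emeasure (distr L ?P Z) (prod_emb UNIV (\<lambda>_. borel) J (Pi\<^sub>E J A)) =
        emeasure L {\<omega> \<in> space L. \<forall>i\<in>J. Z \<omega> i \<in> A i}" if "Z \<in> L \<rightarrow>\<^sub>M ?P" for L and Z :: "_ \<Rightarrow> path"
    proof -
      have "prod_emb UNIV (\<lambda>_. borel) J (Pi\<^sub>E J A) \<in> sets ?P"
        using J by (intro sets_PiM_I) auto
      moreover have "Z -` prod_emb UNIV (\<lambda>_. borel) J (Pi\<^sub>E J A) \<inter> space L = {\<omega> \<in> space L. \<forall>i\<in>J. Z \<omega> i \<in> A i}"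
        by (auto simp: prod_emb_def PiE_iff)
      ultimately show ?thesis using that by (simp add: emeasure_distr)
    qed
    have J': "J \<subseteq> t ` {..n}" "0 \<in> t ` {..n}" unfolding tK by (auto simp: K_def)
    show "emeasure (distr M ?P X) (prod_emb UNIV (\<lambda>_. borel) J (Pi\<^sub>E J A)) =
        emeasure (distr N ?P Y) (prod_emb UNIV (\<lambda>_. borel) J (Pi\<^sub>E J A))"
      unfolding cyl[OF XP] cyl[OF YP]
      using BM_cylinder[OF X t J' n, of A] BM_cylinder[OF Y t J' n, of A] J(2) by simp
  qed simp_all
  show ?thesis
  proof (rule measure_eqI)
    fix B assume B: "B \<in> sets (distr M \<Omega> X)"
    then obtain B' where B': "B' \<in> sets ?P" "B = {\<omega>. continuous_on UNIV \<omega>} \<inter> B'"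
      by (auto simp: \<Omega>_def sets_restrict_space)
    have *: "emeasure (distr L \<Omega> Z) B = emeasure (distr L ?P Z) B'"
      if [measurable]: "Z \<in> L \<rightarrow>\<^sub>M \<Omega>" and Z: "Z \<in> L \<rightarrow>\<^sub>M ?P" for L and Z :: "_ \<Rightarrow> path"
    proof -
      have "Z -` B \<inter> space L = Z -` B' \<inter> space L"
        using measurable_space[OF that(1)] by (auto simp: B' space_Omega)
      then show ?thesis using B B' Z by (simp add: emeasure_distr)
    qed
    show "emeasure (distr M \<Omega> X) B = emeasure (distr N \<Omega> Y) B"
      using *[OF X' XP] *[OF Y' YP] eqP by simp
  qed simp
qed

text \<open>Every clause of the definition is a property of the law: almost sure statements and
  distributions pass through the image measure, and independence is rewritten as factorization of a
  joint law.\<close>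

lemma BM_transfer:
  assumes BM: "two_sided_standard_BM P0 (\<lambda>\<omega>. \<omega>)" and M: "prob_space M"
    and Y [measurable]: "Y \<in> M \<rightarrow>\<^sub>M \<Omega>" and eq: "distr M \<Omega> Y = P0"
  shows "two_sided_standard_BM M Y"
proof -
  interpret M: prob_space M by fact
  interpret P0: prob_space P0 using BM by (simp add: two_sided_standard_BM_def)
  have [measurable_cong]: "sets P0 = sets \<Omega>" unfolding eq[symmetric] by simp
  have d: "distr M L (\<lambda>\<omega>. g (Y \<omega>)) = distr P0 L g" if "g \<in> \<Omega> \<rightarrow>\<^sub>M L" for g and L :: "'c measure"
    unfolding eq[symmetric] using that by (simp add: distr_distr comp_def)
  have "AE \<omega> in M. Y \<omega> 0 = 0"
  proof (rule AE_distrD[OF Y, of "\<lambda>\<omega>. \<omega> 0 = 0"])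
    show "AE \<omega> in distr M \<Omega> Y. \<omega> 0 = 0"
      unfolding eq using BM by (simp add: two_sided_standard_BM_def)
  qed
  moreover have "distributed M lborel (\<lambda>\<omega>. Y \<omega> t - Y \<omega> s) (normal_density 0 (sqrt (t - s)))" if "s < t" for s t
  proof -
    have "distributed P0 lborel (\<lambda>\<omega>. \<omega> t - \<omega> s) (normal_density 0 (sqrt (t - s)))"
      using BM that by (simp add: two_sided_standard_BM_def)
    then show ?thesis
      using d[of "\<lambda>\<omega>. \<omega> t - \<omega> s" lborel] measurable_compose[OF Y, of "\<lambda>\<omega>. \<omega> t - \<omega> s" lborel]
      by (simp add: distributed_def)
  qed
  moreover have "M.indep_vars (\<lambda>_. borel) (\<lambda>i \<omega>. Y \<omega> (t (Suc i)) - Y \<omega> (t i)) {..<n}"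
    if t: "strict_mono_on {..n} t" for n and t :: "nat \<Rightarrow> real"
  \<comment> \<open>The factorization criterion for independence is applied to a nonempty index set;
    an empty family is independent by definition.\<close>
  proof (cases "n = 0")
    case True
    then show ?thesis by (simp add: M.indep_vars_def M.indep_sets_def)
  next
    case False
    have [measurable]: "(\<lambda>\<omega>. Y \<omega> s) \<in> borel_measurable M" for s
      by (rule measurable_coordinate_at) simp_all
    have "P0.indep_vars (\<lambda>_. borel) (\<lambda>i \<omega>. \<omega> (t (Suc i)) - \<omega> (t i)) {..<n}"
      using BM t by (simp add: two_sided_standard_BM_def)
    then have "distr P0 (PiM {..<n} (\<lambda>_. borel)) (\<lambda>\<omega>. \<lambda>i\<in>{..<n}. \<omega> (t (Suc i)) - \<omega> (t i)) =
        PiM {..<n} (\<lambda>i. distr P0 borel (\<lambda>\<omega>. \<omega> (t (Suc i)) - \<omega> (t i)))"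
      using False by (subst (asm) P0.indep_vars_iff_distr_eq_PiM) auto
    then show ?thesis
      using False
        d[of "\<lambda>\<omega>. \<lambda>i\<in>{..<n}. \<omega> (t (Suc i)) - \<omega> (t i)" "PiM {..<n} (\<lambda>_. borel)"]
        d[of "\<lambda>\<omega>. \<omega> (t (Suc i)) - \<omega> (t i)" borel for i]
      by (subst M.indep_vars_iff_distr_eq_PiM) auto
  qed
  ultimately show ?thesis
    using M Y unfolding two_sided_standard_BM_def by auto
qed

text \<open>Increments of the pinned path over [u, v] are increments of the original over
  [s + u, s + v], and the definition sees only the lengths and the order of the times.\<close>

lemma BM_pinned:
  assumes BM: "two_sided_standard_BM P0 (\<lambda>\<omega>. \<omega>)" and [measurable_cong]: "sets P0 = sets \<Omega>"
  shows "two_sided_standard_BM P0 (pinned s)"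
proof -
  have "prob_space.indep_vars P0 (\<lambda>_. borel) (\<lambda>i \<omega>. pinned s \<omega> (t (Suc i)) - pinned s \<omega> (t i)) {..<n}"
    if t: "strict_mono_on {..n} t" for n and t :: "nat \<Rightarrow> real"
  proof -
    have "strict_mono_on {..n} (\<lambda>i. s + t i)"
      using t by (auto simp: strict_mono_on_def)
    then have "prob_space.indep_vars P0 (\<lambda>_. borel) (\<lambda>i \<omega>. \<omega> (s + t (Suc i)) - \<omega> (s + t i)) {..<n}"
      using BM by (auto simp: two_sided_standard_BM_def)
    then show ?thesis by (simp add: pinned_def)
  qed
  moreover have "distributed P0 lborel (\<lambda>\<omega>. pinned s \<omega> v - pinned s \<omega> u) (normal_density 0 (sqrt (v - u)))"
    if "u < v" for u v
  proof -
    have "distributed P0 lborel (\<lambda>\<omega>. \<omega> (s + v) - \<omega> (s + u)) (normal_density 0 (sqrt ((s + v) - (s + u))))"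
      using BM that unfolding two_sided_standard_BM_def by (simp only: add_strict_left_mono)
    then show ?thesis by (simp add: pinned_def)
  qed
  moreover have "pinned s \<in> P0 \<rightarrow>\<^sub>M \<Omega>" by measurable
  ultimately show ?thesis
    using BM by (simp add: two_sided_standard_BM_def) (simp add: pinned_def)
qed

text \<open>Uniqueness of the law turns the Brownian property into an equality of measures, the form
  that can be used under integrals.\<close>

lemma distr_pinned:
  assumes "two_sided_standard_BM P0 (\<lambda>\<omega>. \<omega>)" and S: "sets P0 = sets \<Omega>"
  shows "distr P0 \<Omega> (pinned s) = P0"
  using BM_law_unique[OF BM_pinned[OF assms, of s] assms(1)] distr_id2[OF S[symmetric]] by (rule trans)

subsection \<open>The Palm formula\<close>

text \<open>The kernel k stands for the local time at 0, and \<open>k (lift (- x) \<omega>)\<close>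
  is then the local time at x. Local finiteness and concentration on the zeros hold for every path;
  the occupation, diffuseness and covariance requirements are almost sure, and for occupation and
  covariance the null set may depend on the parameters.\<close>

locale brownian_kernel =
  fixes P0 :: "path measure" and k :: "path \<Rightarrow> real measure"
  assumes sets_P0 [measurable_cong]: "sets P0 = sets \<Omega>"
    and BM: "two_sided_standard_BM P0 (\<lambda>\<omega>. \<omega>)"
    and sets_k: "\<omega> \<in> space \<Omega> \<Longrightarrow> sets (k \<omega>) = sets borel"
    and measurable_k: "C \<in> sets borel \<Longrightarrow> (\<lambda>\<omega>. emeasure (k \<omega>) C) \<in> borel_measurable \<Omega>"
    and finite_k: "\<omega> \<in> space \<Omega> \<Longrightarrow> emeasure (k \<omega>) {a..b} < \<infinity>"
    and occupation: "B \<in> sets borel \<Longrightarrow>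
      AE \<omega> in P0. (\<integral>\<^sup>+x. emeasure (k (lift (- x) \<omega>)) B \<partial>lborel) = emeasure lborel B"
    and carried: "\<omega> \<in> space \<Omega> \<Longrightarrow> AE s in k \<omega>. \<omega> s = 0"
    and diffuse_k: "AE \<omega> in P0. \<forall>t. emeasure (k \<omega>) {t} = 0"
    and covariant: "C \<in> sets borel \<Longrightarrow>
      AE \<omega> in P0. emeasure (k (shift t (lift x \<omega>))) ((\<lambda>s. s - t) ` C) = emeasure (k (lift x \<omega>)) C"
begin

sublocale P0: prob_space P0
  using BM by (simp add: two_sided_standard_BM_def)

sublocale pair_sigma_finite lborel P0 ..

lemma space_P0: "space P0 = space \<Omega>"
  using sets_eq_imp_space_eq[OF sets_P0] .

lemma space_k: "\<omega> \<in> space \<Omega> \<Longrightarrow> space (k \<omega>) = UNIV"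
  using sets_eq_imp_space_eq[OF sets_k] by simp

lemma measurable_k_iff: "\<omega> \<in> space \<Omega> \<Longrightarrow> f \<in> measurable (k \<omega>) N \<longleftrightarrow> f \<in> measurable borel N"
  using measurable_cong_sets[OF sets_k refl] by blast

text \<open>The measures k are only locally finite. Cut to [-n, n] and divided by 1 plus the mass of
  the window they become subprobability kernels; multiplying back and letting n grow recovers the
  integral as a supremum. The summand 1 keeps the normalizer invertible when the window carries no
  mass.\<close>

lemma measurable_kernel_integral:
  assumes \<phi> [measurable]: "\<phi> \<in> M \<rightarrow>\<^sub>M \<Omega>"
    and f [measurable]: "(\<lambda>(z, s). f z s) \<in> borel_measurable (M \<Otimes>\<^sub>M borel)"
  shows "(\<lambda>z. \<integral>\<^sup>+s. f z s \<partial>k (\<phi> z)) \<in> borel_measurable M"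
proof -
  define N where "N n z = 1 + emeasure (k (\<phi> z)) {-real n..real n}" for n z
  define \<kappa> where "\<kappa> n z = density (k (\<phi> z)) (\<lambda>s. inverse (N n z) * indicator {-real n..real n} s)" for n z
  have \<phi>': "\<phi> z \<in> space \<Omega>" if "z \<in> space M" for z
    using measurable_space[OF \<phi> that] .
  have N [measurable]: "N n \<in> borel_measurable M" for n
    unfolding N_def using measurable_compose[OF \<phi> measurable_k] by measurable
  have N_fin: "N n z \<noteq> 0 \<and> N n z < top" if "z \<in> space M" for n z
    using finite_k[OF \<phi>'[OF that]] by (auto simp: N_def)
  have \<kappa>_int: "(\<integral>\<^sup>+s. g s \<partial>\<kappa> n z) = inverse (N n z) * (\<integral>\<^sup>+s. indicator {-real n..real n} s * g s \<partial>k (\<phi> z))"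
    if "z \<in> space M" "g \<in> borel_measurable borel" for n z g
    unfolding \<kappa>_def using that(2) \<phi>'[OF that(1)]
    by (subst nn_integral_density)
       (auto simp: measurable_k_iff mult.assoc nn_integral_cmult)
  have \<kappa>_em: "emeasure (\<kappa> n z) C = inverse (N n z) * emeasure (k (\<phi> z)) ({-real n..real n} \<inter> C)"
    if "z \<in> space M" "C \<in> sets borel" for n z C
  proof -
    have "emeasure (\<kappa> n z) C = (\<integral>\<^sup>+s. indicator C s \<partial>\<kappa> n z)"
      using that \<phi>'[OF that(1)] by (simp add: \<kappa>_def sets_k)
    also have "\<dots> = inverse (N n z) * (\<integral>\<^sup>+s. indicator ({-real n..real n} \<inter> C) s \<partial>k (\<phi> z))"
      using that by (simp add: \<kappa>_int indicator_inter_arith)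
    also have "(\<integral>\<^sup>+s. indicator ({-real n..real n} \<inter> C) s \<partial>k (\<phi> z)) = emeasure (k (\<phi> z)) ({-real n..real n} \<inter> C)"
      using that by (intro nn_integral_indicator) (simp add: sets_k[OF \<phi>'])
    finally show ?thesis .
  qed
  have \<kappa> [measurable]: "\<kappa> n \<in> M \<rightarrow>\<^sub>M subprob_algebra borel" for n
  proof (rule measurable_subprob_algebra)
    fix z assume z: "z \<in> space M"
    show "sets (\<kappa> n z) = sets borel" using \<phi>'[OF z] by (simp add: \<kappa>_def sets_k)
    show "subprob_space (\<kappa> n z)"
    proof
      have "emeasure (\<kappa> n z) UNIV = inverse (N n z) * emeasure (k (\<phi> z)) {-real n..real n}"
        using \<kappa>_em[OF z, of UNIV] by simp
      also have "\<dots> \<le> inverse (N n z) * N n z"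
        by (intro mult_left_mono) (auto simp: N_def)
      also have "\<dots> = 1" using N_fin[OF z, of n]
        by (metis ennreal_divide_self divide_ennreal_def mult.commute)
      finally show "emeasure (\<kappa> n z) (space (\<kappa> n z)) \<le> 1"
        using \<phi>'[OF z] by (simp add: \<kappa>_def space_k)
      show "space (\<kappa> n z) \<noteq> {}" using \<phi>'[OF z] by (simp add: \<kappa>_def space_k)
    qed
  next
    fix C :: "real set" assume C: "C \<in> sets borel"
    have "(\<lambda>z. inverse (N n z) * emeasure (k (\<phi> z)) ({-real n..real n} \<inter> C)) \<in> borel_measurable M"
      using measurable_compose[OF \<phi> measurable_k[of "{-real n..real n} \<inter> C"]] C by measurable
    then show "(\<lambda>z. emeasure (\<kappa> n z) C) \<in> borel_measurable M"
      by (rule measurable_cong[THEN iffD1, rotated]) (simp add: \<kappa>_em C)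
  qed
  have fz: "f z \<in> borel_measurable borel" if "z \<in> space M" for z
    using measurable_compose[OF measurable_Pair1'[OF that] f] by simp
  have "(\<integral>\<^sup>+s. f z s \<partial>k (\<phi> z)) = (SUP n. N n z * (\<integral>\<^sup>+s. f z s \<partial>\<kappa> n z))" if z: "z \<in> space M" for z
  proof -
    have "N n z * (\<integral>\<^sup>+s. f z s \<partial>\<kappa> n z) = (\<integral>\<^sup>+s. indicator {-real n..real n} s * f z s \<partial>k (\<phi> z))" for n
    proof -
      have "N n z * inverse (N n z) = 1" using N_fin[OF z, of n]
        by (metis ennreal_divide_self divide_ennreal_def)
      then show ?thesis by (simp add: \<kappa>_int[OF z fz[OF z]] mult.assoc[symmetric])
    qed
    moreover have "(SUP n. \<integral>\<^sup>+s. indicator {-real n..real n} s * f z s \<partial>k (\<phi> z)) =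
        (\<integral>\<^sup>+s. (SUP n. indicator {-real n..real n} s * f z s) \<partial>k (\<phi> z))"
    proof (rule nn_integral_monotone_convergence_SUP[symmetric])
      show "incseq (\<lambda>n s. indicator {-real n..real n} s * f z s)"
        by (auto simp: incseq_def le_fun_def split: split_indicator)
      show "(\<lambda>s. indicator {-real n..real n} s * f z s) \<in> borel_measurable (k (\<phi> z))" for n
        using fz[OF z] by (simp add: measurable_k_iff \<phi>'[OF z])
    qed
    moreover have "(SUP n. indicator {-real n..real n} s * f z s) = f z s" for s
    proof (rule antisym)
      show "(SUP n. indicator {-real n..real n} s * f z s) \<le> f z s"
        by (rule SUP_least) (auto split: split_indicator)
      obtain n where "\<bar>s\<bar> < real n" using reals_Archimedean2 by blast
      then show "f z s \<le> (SUP n. indicator {-real n..real n} s * f z s)"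
        by (intro SUP_upper2[of n]) (auto split: split_indicator)
    qed
    ultimately show ?thesis by simp
  qed
  moreover have "(\<lambda>z. SUP n. N n z * (\<integral>\<^sup>+s. f z s \<partial>\<kappa> n z)) \<in> borel_measurable M"
    using nn_integral_measurable_subprob_algebra2[OF f \<kappa>] by measurable
  ultimately show ?thesis by (subst measurable_cong) auto
qed

definition Q :: "path measure" where
  "Q = distr (lborel \<Otimes>\<^sub>M P0) \<Omega> (\<lambda>(x, \<omega>). lift x \<omega>)"

lemma sets_Q [measurable_cong, simp]: "sets Q = sets \<Omega>"
  by (simp add: Q_def)

lemma space_Q: "space Q = space \<Omega>"
  by (simp add: Q_def)

lemma nn_integral_Q:
  assumes [measurable]: "G \<in> borel_measurable \<Omega>"
  shows "(\<integral>\<^sup>+\<omega>. G \<omega> \<partial>Q) = (\<integral>\<^sup>+x. \<integral>\<^sup>+\<omega>. G (lift x \<omega>) \<partial>P0 \<partial>lborel)"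
    and "(\<integral>\<^sup>+\<omega>. G \<omega> \<partial>Q) = (\<integral>\<^sup>+\<omega>. \<integral>\<^sup>+x. G (lift x \<omega>) \<partial>lborel \<partial>P0)"
proof -
  have *: "(\<integral>\<^sup>+\<omega>. G \<omega> \<partial>Q) = (\<integral>\<^sup>+z. (\<lambda>(x, \<omega>). G (lift x \<omega>)) z \<partial>(lborel \<Otimes>\<^sub>M P0))"
    unfolding Q_def by (subst nn_integral_distr) (simp_all add: case_prod_unfold)
  show "(\<integral>\<^sup>+\<omega>. G \<omega> \<partial>Q) = (\<integral>\<^sup>+x. \<integral>\<^sup>+\<omega>. G (lift x \<omega>) \<partial>P0 \<partial>lborel)"
    unfolding * by (subst P0.nn_integral_fst[symmetric]) simp_all
  show "(\<integral>\<^sup>+\<omega>. G \<omega> \<partial>Q) = (\<integral>\<^sup>+\<omega>. \<integral>\<^sup>+x. G (lift x \<omega>) \<partial>lborel \<partial>P0)"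
    unfolding * by (subst nn_integral_snd[symmetric]) simp_all
qed

lemma nn_integral_pinned:
  assumes [measurable]: "G \<in> borel_measurable \<Omega>"
  shows "(\<integral>\<^sup>+\<omega>. G (pinned t \<omega>) \<partial>P0) = (\<integral>\<^sup>+\<omega>. G \<omega> \<partial>P0)"
proof -
  have "(\<integral>\<^sup>+\<omega>. G (pinned t \<omega>) \<partial>P0) = (\<integral>\<^sup>+\<omega>. G \<omega> \<partial>distr P0 \<Omega> (pinned t))"
    by (subst nn_integral_distr) simp_all
  then show ?thesis by (simp only: distr_pinned[OF BM sets_P0])
qed

lemma nn_integral_lborel_shift:
  fixes f :: "real \<Rightarrow> ennreal"
  assumes [measurable]: "f \<in> borel_measurable borel"
  shows "(\<integral>\<^sup>+x. f (x + c) \<partial>lborel) = (\<integral>\<^sup>+x. f x \<partial>lborel)"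
  using nn_integral_real_affine[of f 1 c] by (simp add: add.commute)

text \<open>By \<open>shift_lift\<close> the shift displaces the offset by
  \<open>\<omega> t\<close>, absorbed by translation invariance for each fixed path, and pins the
  path, absorbed by the invariance of P0.\<close>

lemma nn_integral_Q_shift:
  assumes [measurable]: "G \<in> borel_measurable \<Omega>"
  shows "(\<integral>\<^sup>+\<omega>. G (shift t \<omega>) \<partial>Q) = (\<integral>\<^sup>+\<omega>. G \<omega> \<partial>Q)"
proof -
  have "(\<integral>\<^sup>+\<omega>. G (shift t \<omega>) \<partial>Q) = (\<integral>\<^sup>+\<omega>. \<integral>\<^sup>+x. G (lift (x + \<omega> t) (pinned t \<omega>)) \<partial>lborel \<partial>P0)"
    by (subst nn_integral_Q(2)) (simp_all add: shift_lift)
  also have "\<dots> = (\<integral>\<^sup>+\<omega>. \<integral>\<^sup>+x. G (lift x (pinned t \<omega>)) \<partial>lborel \<partial>P0)"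
  proof (rule nn_integral_cong)
    fix \<omega> assume "\<omega> \<in> space P0"
    then have "(\<lambda>x. lift x (pinned t \<omega>)) \<in> borel \<rightarrow>\<^sub>M \<Omega>" by (simp add: space_P0)
    then have "(\<lambda>x. G (lift x (pinned t \<omega>))) \<in> borel_measurable borel" by measurable
    then show "(\<integral>\<^sup>+x. G (lift (x + \<omega> t) (pinned t \<omega>)) \<partial>lborel) = (\<integral>\<^sup>+x. G (lift x (pinned t \<omega>)) \<partial>lborel)"
      by (rule nn_integral_lborel_shift)
  qed
  also have "\<dots> = (\<integral>\<^sup>+\<omega>. \<integral>\<^sup>+x. G (lift x \<omega>) \<partial>lborel \<partial>P0)"
    by (rule nn_integral_pinned[where G="\<lambda>\<omega>. \<integral>\<^sup>+x. G (lift x \<omega>) \<partial>lborel"]) measurable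
  also have "\<dots> = (\<integral>\<^sup>+\<omega>. G \<omega> \<partial>Q)" by (subst nn_integral_Q(2)) simp_all
  finally show ?thesis .
qed

lemma AE_Q:
  assumes [measurable]: "Measurable.pred \<Omega> P" and "\<And>x. AE \<omega> in P0. P (lift x \<omega>)"
  shows "AE \<omega> in Q. P \<omega>"
proof -
  have [measurable]: "Measurable.pred (lborel \<Otimes>\<^sub>M P0) (\<lambda>z. P (case z of (x, \<omega>) \<Rightarrow> lift x \<omega>))"
    by (rule measurable_compose[OF _ assms(1)]) (simp add: case_prod_unfold)
  have "AE z in lborel \<Otimes>\<^sub>M P0. P (case z of (x, \<omega>) \<Rightarrow> lift x \<omega>)"
  proof (rule AE_pair_measure)
    show "{z \<in> space (lborel \<Otimes>\<^sub>M P0). P (case z of (x, \<omega>) \<Rightarrow> lift x \<omega>)} \<in> sets (lborel \<Otimes>\<^sub>M P0)"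
      by measurable
  qed (use assms(2) in simp)
  then show ?thesis unfolding Q_def by (subst AE_distr_iff) simp_all
qed

text \<open>The occupation requirement covers sets B that ignore the path. Both sides are measures
  as functions of f, and they agree on rectangles A \<times> B because the indicator of A factors
  out; \<sigma>-finiteness makes this enough. Test functions may then depend on the path, as the
  Palm formula demands.\<close>

lemma occupation_joint:
  assumes [measurable]: "f \<in> borel_measurable (\<Omega> \<Otimes>\<^sub>M borel)"
  shows "(\<integral>\<^sup>+\<omega>. \<integral>\<^sup>+x. \<integral>\<^sup>+s. f (\<omega>, s) \<partial>k (lift (- x) \<omega>) \<partial>lborel \<partial>P0) =
    (\<integral>\<^sup>+z. f z \<partial>(P0 \<Otimes>\<^sub>M lborel))"
proof -
  let ?M = "P0 \<Otimes>\<^sub>M (lborel :: real measure)"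
  define \<Phi> where "\<Phi> g = (\<integral>\<^sup>+\<omega>. \<integral>\<^sup>+x. \<integral>\<^sup>+s. g (\<omega>, s) \<partial>k (lift (- x) \<omega>) \<partial>lborel \<partial>P0)" for g
  have in_Omega: "lift x \<omega> \<in> space \<Omega>" if "\<omega> \<in> space P0" for x \<omega>
    using that by (simp add: space_P0 lift_in_Omega)
  have m1: "(\<lambda>z. \<integral>\<^sup>+s. g (fst z, s) \<partial>k (lift (- snd z) (fst z))) \<in> borel_measurable ?M"
    if [measurable]: "g \<in> borel_measurable ?M" for g :: "_ \<Rightarrow> ennreal"
    by (rule measurable_kernel_integral) measurable
  have m2: "(\<lambda>x. \<integral>\<^sup>+s. g (\<omega>, s) \<partial>k (lift (- x) \<omega>)) \<in> borel_measurable borel"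
    if "g \<in> borel_measurable ?M" "\<omega> \<in> space P0" for g :: "_ \<Rightarrow> ennreal" and \<omega>
    using measurable_compose[OF measurable_Pair1'[OF that(2)] m1[OF that(1)]] by simp
  have m3: "(\<lambda>s. g (\<omega>, s)) \<in> borel_measurable (k (lift x \<omega>))"
    if "g \<in> borel_measurable ?M" "\<omega> \<in> space P0" for g :: "_ \<Rightarrow> ennreal" and \<omega> x
    using measurable_compose[OF measurable_Pair1'[OF that(2)] that(1)] in_Omega[OF that(2)]
    by (simp add: measurable_k_iff)
  have m4: "(\<lambda>\<omega>. \<integral>\<^sup>+x. \<integral>\<^sup>+s. g (\<omega>, s) \<partial>k (lift (- x) \<omega>) \<partial>lborel) \<in> borel_measurable P0"
    if "g \<in> borel_measurable ?M" for g :: "_ \<Rightarrow> ennreal"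
    by (rule lborel.borel_measurable_nn_integral) (use m1[OF that] in \<open>simp add: case_prod_unfold\<close>)
  define N where "N = measure_of (space ?M) (sets ?M) (\<lambda>E. \<Phi> (indicator E))"
  have em: "emeasure N E = \<Phi> (indicator E)" if "E \<in> sets ?M" for E
    unfolding N_def
  proof (rule emeasure_measure_of_sigma)
    show "sigma_algebra (space ?M) (sets ?M)" ..
    show "positive (sets ?M) (\<lambda>E. \<Phi> (indicator E))" by (simp add: positive_def \<Phi>_def)
    show "countably_additive (sets ?M) (\<lambda>E. \<Phi> (indicator E))"
    proof (rule countably_additiveI)
      fix A :: "nat \<Rightarrow> _" assume A: "range A \<subseteq> sets ?M" "disjoint_family A"
      have Ai: "indicator (A i) \<in> borel_measurable ?M" for i
        using A(1) by (intro borel_measurable_indicator) auto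
      have "\<Phi> (indicator (\<Union>i. A i)) = (\<integral>\<^sup>+\<omega>. \<integral>\<^sup>+x. \<integral>\<^sup>+s. (\<Sum>i. indicator (A i) (\<omega>, s)) \<partial>k (lift (- x) \<omega>) \<partial>lborel \<partial>P0)"
        unfolding \<Phi>_def by (simp add: suminf_indicator[OF A(2)])
      also have "\<dots> = (\<integral>\<^sup>+\<omega>. \<integral>\<^sup>+x. (\<Sum>i. \<integral>\<^sup>+s. indicator (A i) (\<omega>, s) \<partial>k (lift (- x) \<omega>)) \<partial>lborel \<partial>P0)"
        by (intro nn_integral_cong nn_integral_suminf m3 Ai)
      also have "\<dots> = (\<integral>\<^sup>+\<omega>. (\<Sum>i. \<integral>\<^sup>+x. \<integral>\<^sup>+s. indicator (A i) (\<omega>, s) \<partial>k (lift (- x) \<omega>) \<partial>lborel) \<partial>P0)"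
        using m2[OF Ai] by (intro nn_integral_cong nn_integral_suminf) simp
      also have "\<dots> = (\<Sum>i. \<Phi> (indicator (A i)))"
        unfolding \<Phi>_def by (intro nn_integral_suminf m4 Ai)
      finally show "(\<Sum>i. \<Phi> (indicator (A i))) = \<Phi> (indicator (\<Union>i. A i))" by simp
    qed
  qed (use that in auto)
  have "?M = N"
  proof (rule pair_measure_eqI)
    show "sets ?M = sets N" unfolding N_def by (rule sets.sets_measure_of_eq[symmetric])
    fix A and B :: "real set" assume A: "A \<in> sets P0" and B: "B \<in> sets lborel"
    have "emeasure N (A \<times> B) = \<Phi> (indicator (A \<times> B))" using A B by (intro em) auto
    also have "\<dots> = (\<integral>\<^sup>+\<omega>. indicator A \<omega> * (\<integral>\<^sup>+x. emeasure (k (lift (- x) \<omega>)) B \<partial>lborel) \<partial>P0)"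
      unfolding \<Phi>_def
    proof (intro nn_integral_cong)
      fix \<omega> assume \<omega>: "\<omega> \<in> space P0"
      have "(\<integral>\<^sup>+s. indicator (A \<times> B) (\<omega>, s) \<partial>k (lift (- x) \<omega>)) = indicator A \<omega> * emeasure (k (lift (- x) \<omega>)) B" for x
        using B by (simp add: indicator_times nn_integral_cmult measurable_k_iff in_Omega[OF \<omega>] sets_k)
      moreover have "(\<lambda>x. emeasure (k (lift (- x) \<omega>)) B) \<in> borel_measurable lborel"
        using measurable_compose[OF _ measurable_k, of "\<lambda>x. lift (- x) \<omega>" borel B] \<omega> B by (simp add: space_P0)
      ultimately show "(\<integral>\<^sup>+x. \<integral>\<^sup>+s. indicator (A \<times> B) (\<omega>, s) \<partial>k (lift (- x) \<omega>) \<partial>lborel) =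
          indicator A \<omega> * (\<integral>\<^sup>+x. emeasure (k (lift (- x) \<omega>)) B \<partial>lborel)"
        by (simp add: nn_integral_cmult)
    qed
    \<comment> \<open>One rectangle at a time, so the null set may depend on B.\<close>
    also have "\<dots> = (\<integral>\<^sup>+\<omega>. indicator A \<omega> * emeasure lborel B \<partial>P0)"
      using occupation[of B] B by (intro nn_integral_cong_AE) (auto elim: eventually_mono)
    also have "\<dots> = emeasure P0 A * emeasure lborel B"
      using A by (simp add: nn_integral_multc)
    finally show "emeasure P0 A * emeasure lborel B = emeasure N (A \<times> B)" ..
  qed (auto intro: P0.sigma_finite_measure_axioms sigma_finite_lborel)
  then have *: "emeasure ?M E = \<Phi> (indicator E)" if "E \<in> sets ?M" for E
    using em[OF that] by simp
  have "f \<in> borel_measurable ?M" by measurable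
  then have "\<Phi> f = (\<integral>\<^sup>+z. f z \<partial>?M)"
  proof (induct rule: borel_measurable_induct)
    case (cong f g)
    have "\<Phi> g = \<Phi> f" unfolding \<Phi>_def
      using cong(3) in_Omega
      by (intro nn_integral_cong) (auto simp: space_pair_measure)
    moreover have "(\<integral>\<^sup>+z. g z \<partial>?M) = (\<integral>\<^sup>+z. f z \<partial>?M)"
      using cong(3) by (intro nn_integral_cong) simp
    ultimately show ?case using cong by simp
  next
    case (set A)
    then show ?case by (simp add: *[symmetric])
  next
    case (mult u c)
    have "\<Phi> (\<lambda>z. c * u z) = c * \<Phi> u"
      unfolding \<Phi>_def using mult m3[OF mult(2)] m2[OF mult(2)] m4[OF mult(2)]
      by (simp add: nn_integral_cmult cong: nn_integral_cong)
    then show ?case using mult by (simp add: nn_integral_cmult)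
  next
    case (add u v)
    have "\<Phi> (\<lambda>z. v z + u z) = \<Phi> v + \<Phi> u"
      unfolding \<Phi>_def using m3[OF add(1)] m2[OF add(1)] m4[OF add(1)]
        m3[OF add(4)] m2[OF add(4)] m4[OF add(4)]
      by (simp add: nn_integral_add cong: nn_integral_cong)
    then show ?case using add by (simp add: nn_integral_add)
  next
    case (seq U)
    have "\<Phi> (\<lambda>z. SUP i. U i z) = (SUP i. \<Phi> (U i))"
    proof -
      have inc: "incseq (\<lambda>i. U i z)" for z using seq(4) by (simp add: incseq_def le_fun_def del: split_paired_All)
      have "\<Phi> (\<lambda>z. SUP i. U i z) = (\<integral>\<^sup>+\<omega>. \<integral>\<^sup>+x. (SUP i. \<integral>\<^sup>+s. U i (\<omega>, s) \<partial>k (lift (- x) \<omega>)) \<partial>lborel \<partial>P0)"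
        unfolding \<Phi>_def using inc
        by (intro nn_integral_cong nn_integral_monotone_convergence_SUP m3 seq)
           (auto simp: incseq_def le_fun_def)
      also have "\<dots> = (\<integral>\<^sup>+\<omega>. (SUP i. \<integral>\<^sup>+x. \<integral>\<^sup>+s. U i (\<omega>, s) \<partial>k (lift (- x) \<omega>) \<partial>lborel) \<partial>P0)"
        using inc m2[OF seq(1)]
        by (intro nn_integral_cong nn_integral_monotone_convergence_SUP)
           (auto simp: incseq_def le_fun_def intro!: nn_integral_mono)
      also have "\<dots> = (SUP i. \<Phi> (U i))"
        unfolding \<Phi>_def using inc m4[OF seq(1)]
        by (intro nn_integral_monotone_convergence_SUP)
           (auto simp: incseq_def le_fun_def intro!: nn_integral_mono)
      finally show ?thesis .
    qed
    also have "\<dots> = (SUP i. \<integral>\<^sup>+z. U i z \<partial>?M)" using seq(3) by simp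
    also have "\<dots> = (\<integral>\<^sup>+z. (SUP i. U i z) \<partial>?M)"
      using seq by (intro nn_integral_monotone_convergence_SUP[symmetric]) auto
    finally show ?case by (simp add: image_comp SUP_apply[abs_def])
  qed
  then show ?thesis by (simp add: \<Phi>_def)
qed

text \<open>The points s charged by \<open>k (lift (- x) \<omega>)\<close> have
  \<open>\<omega> s = x\<close>, so shifting the lowered path there agrees with
  \<open>pinned s\<close>. The integrand is then free of x, the occupation formula replaces levels
  and local times by Lebesgue measure in s, and for each fixed s the pinned path has law P0.\<close>

lemma palm:
  assumes g [measurable]: "(\<lambda>(\<omega>, s). g \<omega> s) \<in> borel_measurable (\<Omega> \<Otimes>\<^sub>M borel)"
  shows "(\<integral>\<^sup>+\<omega>. \<integral>\<^sup>+s. g (shift s \<omega>) s \<partial>k \<omega> \<partial>Q) = (\<integral>\<^sup>+\<omega>. \<integral>\<^sup>+s. g \<omega> s \<partial>lborel \<partial>P0)"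
proof -
  define I where "I \<omega> = (\<integral>\<^sup>+s. g (shift s \<omega>) s \<partial>k \<omega>)" for \<omega>
  have [measurable]: "I \<in> borel_measurable \<Omega>"
    unfolding I_def by (rule measurable_kernel_integral) measurable
  have "(\<integral>\<^sup>+\<omega>. I \<omega> \<partial>Q) = (\<integral>\<^sup>+\<omega>. \<integral>\<^sup>+x. I (lift x \<omega>) \<partial>lborel \<partial>P0)"
    by (rule nn_integral_Q) simp
  \<comment> \<open>Level x of the path corresponds to offset - x, hence the reflection.\<close>
  also have "\<dots> = (\<integral>\<^sup>+\<omega>. \<integral>\<^sup>+x. I (lift (- x) \<omega>) \<partial>lborel \<partial>P0)"
  proof (rule nn_integral_cong)
    fix \<omega> assume "\<omega> \<in> space P0"
    then have "(\<lambda>x. lift x \<omega>) \<in> borel \<rightarrow>\<^sub>M \<Omega>" by (simp add: space_P0)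
    then have "(\<lambda>x. I (lift x \<omega>)) \<in> borel_measurable borel" by measurable
    from nn_integral_real_affine[OF this, of "-1" 0]
    show "(\<integral>\<^sup>+x. I (lift x \<omega>) \<partial>lborel) = (\<integral>\<^sup>+x. I (lift (- x) \<omega>) \<partial>lborel)" by simp
  qed
  also have "\<dots> = (\<integral>\<^sup>+\<omega>. \<integral>\<^sup>+x. \<integral>\<^sup>+s. (\<lambda>(\<omega>, s). g (pinned s \<omega>) s) (\<omega>, s) \<partial>k (lift (- x) \<omega>) \<partial>lborel \<partial>P0)"
    unfolding I_def
  proof (rule nn_integral_cong, rule nn_integral_cong, rule nn_integral_cong_AE)
    fix \<omega> x assume "\<omega> \<in> space P0"
    then have "AE s in k (lift (- x) \<omega>). lift (- x) \<omega> s = 0"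
      by (intro carried lift_in_Omega) (simp add: space_P0)
    then show "AE s in k (lift (- x) \<omega>). g (shift s (lift (- x) \<omega>)) s = (\<lambda>(\<omega>, s). g (pinned s \<omega>) s) (\<omega>, s)"
      by eventually_elim (simp add: lift_def shift_def pinned_def)
  qed
  also have "\<dots> = (\<integral>\<^sup>+z. (\<lambda>(\<omega>, s). g (pinned s \<omega>) s) z \<partial>(P0 \<Otimes>\<^sub>M lborel))"
    by (rule occupation_joint) measurable
  also have "\<dots> = (\<integral>\<^sup>+\<omega>. \<integral>\<^sup>+s. g (pinned s \<omega>) s \<partial>lborel \<partial>P0)"
    by (subst lborel.nn_integral_fst[symmetric]) simp_all
  also have "\<dots> = (\<integral>\<^sup>+s. \<integral>\<^sup>+\<omega>. g (pinned s \<omega>) s \<partial>P0 \<partial>lborel)"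
    by (rule Fubini') measurable
  also have "\<dots> = (\<integral>\<^sup>+s. \<integral>\<^sup>+\<omega>. g \<omega> s \<partial>P0 \<partial>lborel)"
    by (intro nn_integral_cong nn_integral_pinned) measurable
  also have "\<dots> = (\<integral>\<^sup>+\<omega>. \<integral>\<^sup>+s. g \<omega> s \<partial>lborel \<partial>P0)"
    by (rule Fubini'[symmetric]) measurable
  finally show ?thesis by (simp add: I_def)
qed

text \<open>Time 0 under P0 is a typical point of the local time under \<open>Q\<close>, so an
  almost sure statement at one can be checked at the other. The Palm formula is applied to the
  indicator of the exceptional event, without dependence on s.\<close>

lemma palm_AE:
  assumes [measurable]: "Measurable.pred \<Omega> H"
  shows "(AE \<omega> in P0. H \<omega>) \<longleftrightarrow> (AE \<omega> in Q. AE s in k \<omega>. H (shift s \<omega>))"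
proof -
  have m [measurable]: "(\<lambda>\<omega>. \<integral>\<^sup>+s. indicator {\<omega> \<in> space \<Omega>. \<not> H \<omega>} (shift s \<omega>) \<partial>k \<omega>) \<in> borel_measurable \<Omega>"
    by (rule measurable_kernel_integral) measurable
  have inner: "(\<integral>\<^sup>+s. indicator {\<omega> \<in> space \<Omega>. \<not> H \<omega>} (shift s \<omega>) \<partial>k \<omega>) = 0 \<longleftrightarrow>
      (AE s in k \<omega>. H (shift s \<omega>))" if \<omega>: "\<omega> \<in> space \<Omega>" for \<omega>
  proof -
    have "(\<lambda>s. shift s \<omega>) \<in> borel \<rightarrow>\<^sub>M \<Omega>" using \<omega> by simp
    then have "(\<lambda>s. indicator {\<omega> \<in> space \<Omega>. \<not> H \<omega>} (shift s \<omega>) :: ennreal) \<in> borel_measurable borel"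
      by measurable
    then have "(\<integral>\<^sup>+s. indicator {\<omega> \<in> space \<Omega>. \<not> H \<omega>} (shift s \<omega>) \<partial>k \<omega>) = 0 \<longleftrightarrow>
      (AE s in k \<omega>. indicator {\<omega> \<in> space \<Omega>. \<not> H \<omega>} (shift s \<omega>) = (0 :: ennreal))"
      by (intro nn_integral_0_iff_AE) (simp add: measurable_k_iff \<omega>)
    also have "\<dots> \<longleftrightarrow> (AE s in k \<omega>. H (shift s \<omega>))"
      using shift_in_Omega[OF \<omega>] by (simp add: indicator_def)
    finally show ?thesis .
  qed
  have "(AE \<omega> in P0. H \<omega>) \<longleftrightarrow> emeasure P0 {\<omega> \<in> space \<Omega>. \<not> H \<omega>} = 0"
    by (subst AE_iff_measurable[OF _ refl]) (simp_all add: space_P0)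
  \<comment> \<open>The inner integral is infinite on the exceptional event and 0 elsewhere, so the
    double integral vanishes exactly when that event is null.\<close>
  also have "\<dots> \<longleftrightarrow> (\<integral>\<^sup>+\<omega>. \<integral>\<^sup>+s. indicator {\<omega> \<in> space \<Omega>. \<not> H \<omega>} \<omega> \<partial>(lborel :: real measure) \<partial>P0) = 0"
    by (simp add: nn_integral_cmult nn_integral_multc ennreal_top_mult)
  also have "\<dots> \<longleftrightarrow> (\<integral>\<^sup>+\<omega>. \<integral>\<^sup>+s. indicator {\<omega> \<in> space \<Omega>. \<not> H \<omega>} (shift s \<omega>) \<partial>k \<omega> \<partial>Q) = 0"
    by (subst palm) simp_all
  also have "\<dots> \<longleftrightarrow> (AE \<omega> in Q. (\<integral>\<^sup>+s. indicator {\<omega> \<in> space \<Omega>. \<not> H \<omega>} (shift s \<omega>) \<partial>k \<omega>) = 0)"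
    by (rule nn_integral_0_iff_AE) measurable
  also have "\<dots> \<longleftrightarrow> (AE \<omega> in Q. AE s in k \<omega>. H (shift s \<omega>))"
    by (rule AE_cong) (simp add: inner space_Q)
  finally show ?thesis .
qed

end

subsection \<open>Covariance at points of the local time, and wandering sets\<close>

text \<open>Exhausts an open interval from inside by intervals with slightly retracted ends and
  inserts rationals in between. Bounds at rational ends thus extend to real ends, and only countably
  many null sets have to be united.\<close>

lemma emeasure_Ioo_le_rational:
  fixes \<mu> :: "real measure"
  assumes S: "sets \<mu> = sets borel"
    and le: "\<And>q q'. q \<in> \<rat> \<Longrightarrow> q' \<in> \<rat> \<Longrightarrow> a < q \<Longrightarrow> q' < b \<Longrightarrow> emeasure \<mu> {q - t<..<q' - t} \<le> c"
  shows "emeasure \<mu> {a - t<..<b - t} \<le> c"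
proof -
  let ?A = "\<lambda>n. {a + inverse (real (Suc n)) - t<..<b - inverse (real (Suc n)) - t}"
  have U: "{a - t<..<b - t} = (\<Union>n. ?A n)"
  proof (rule set_eqI)
    fix x
    show "x \<in> {a - t<..<b - t} \<longleftrightarrow> x \<in> (\<Union>n. ?A n)"
    proof
      assume "x \<in> {a - t<..<b - t}"
      then have "0 < min (x + t - a) (b - t - x)" by auto
      from reals_Archimedean[OF this] obtain n where "inverse (real (Suc n)) < min (x + t - a) (b - t - x)" ..
      then show "x \<in> (\<Union>n. ?A n)" by (intro UN_I[of n]) auto
    next
      assume "x \<in> (\<Union>n. ?A n)"
      then obtain n where "x \<in> ?A n" by auto
      moreover have "0 < inverse (real (Suc n))" by simp
      ultimately show "x \<in> {a - t<..<b - t}" unfolding greaterThanLessThan_iff by linarith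
    qed
  qed
  have "incseq ?A"
  proof (rule incseq_SucI)
    fix n
    have "inverse (real (Suc (Suc n))) \<le> inverse (real (Suc n))" by (intro le_imp_inverse_le) auto
    then show "?A n \<le> ?A (Suc n)"
      by (intro subsetI) (unfold greaterThanLessThan_iff, linarith)
  qed
  then have SUP: "(SUP n. emeasure \<mu> (?A n)) = emeasure \<mu> (\<Union>n. ?A n)"
    by (intro SUP_emeasure_incseq) (auto simp: S)
  have "emeasure \<mu> (?A n) \<le> c" for n
  proof -
    obtain q where q: "q \<in> \<rat>" "a < q" "q < a + inverse (real (Suc n))"
      using Rats_dense_in_real[of a "a + inverse (real (Suc n))"] by auto
    obtain q' where q': "q' \<in> \<rat>" "q' < b" "b - inverse (real (Suc n)) < q'"
      using Rats_dense_in_real[of "b - inverse (real (Suc n))" b] by auto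
    have "emeasure \<mu> (?A n) \<le> emeasure \<mu> {q - t<..<q' - t}"
      using q q' by (intro emeasure_mono) (auto simp: S)
    also have "\<dots> \<le> c" using q q' by (intro le)
    finally show ?thesis .
  qed
  then show ?thesis unfolding U SUP[symmetric] by (rule SUP_least)
qed

context brownian_kernel
begin

text \<open>Open intervals suffice to determine the measures, and rational endpoints suffice for the
  intervals; so one null set serves all endpoints and the property is jointly measurable in path and
  shift.\<close>

definition cov :: "path \<Rightarrow> real \<Rightarrow> bool" where
  "cov \<omega> t \<longleftrightarrow> (\<forall>a b. emeasure (k (shift t \<omega>)) {a - t<..<b - t} = emeasure (k \<omega>) {a<..<b})"

lemma cov_rational:
  assumes \<omega>: "\<omega> \<in> space \<Omega>"
  shows "cov \<omega> t \<longleftrightarrow>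
    (\<forall>q\<in>\<rat>. \<forall>q'\<in>\<rat>. emeasure (k (shift t \<omega>)) {q - t<..<q' - t} = emeasure (k \<omega>) {q<..<q'})"
proof
  assume R: "\<forall>q\<in>\<rat>. \<forall>q'\<in>\<rat>. emeasure (k (shift t \<omega>)) {q - t<..<q' - t} = emeasure (k \<omega>) {q<..<q'}"
  show "cov \<omega> t" unfolding cov_def
  proof (intro allI antisym)
    fix a b
    show "emeasure (k (shift t \<omega>)) {a - t<..<b - t} \<le> emeasure (k \<omega>) {a<..<b}"
    proof (rule emeasure_Ioo_le_rational)
      fix q q' assume q: "q \<in> \<rat>" "q' \<in> \<rat>" "a < q" "q' < b"
      have "emeasure (k (shift t \<omega>)) {q - t<..<q' - t} = emeasure (k \<omega>) {q<..<q'}" using R q by simp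
      also have "\<dots> \<le> emeasure (k \<omega>) {a<..<b}" using q by (intro emeasure_mono) (auto simp: sets_k \<omega>)
      finally show "emeasure (k (shift t \<omega>)) {q - t<..<q' - t} \<le> emeasure (k \<omega>) {a<..<b}" .
    qed (simp add: sets_k shift_in_Omega \<omega>)
    have "emeasure (k \<omega>) {a - 0<..<b - 0} \<le> emeasure (k (shift t \<omega>)) {a - t<..<b - t}"
    proof (rule emeasure_Ioo_le_rational)
      fix q q' assume q: "q \<in> \<rat>" "q' \<in> \<rat>" "a < q" "q' < b"
      have "emeasure (k \<omega>) {q - 0<..<q' - 0} = emeasure (k (shift t \<omega>)) {q - t<..<q' - t}" using R q by simp
      also have "\<dots> \<le> emeasure (k (shift t \<omega>)) {a - t<..<b - t}"
        using q by (intro emeasure_mono) (auto simp: sets_k shift_in_Omega \<omega>)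
      finally show "emeasure (k \<omega>) {q - 0<..<q' - 0} \<le> emeasure (k (shift t \<omega>)) {a - t<..<b - t}" .
    qed (simp add: sets_k \<omega>)
    then show "emeasure (k \<omega>) {a<..<b} \<le> emeasure (k (shift t \<omega>)) {a - t<..<b - t}" by simp
  qed
qed (simp add: cov_def)

lemma measurable_emeasure_k:
  assumes [measurable]: "\<phi> \<in> M \<rightarrow>\<^sub>M \<Omega>" and A [measurable]: "Measurable.pred (M \<Otimes>\<^sub>M borel) (\<lambda>(z, s). s \<in> A z)"
  shows "(\<lambda>z. emeasure (k (\<phi> z)) (A z)) \<in> borel_measurable M"
proof -
  have A': "A z \<in> sets borel" if "z \<in> space M" for z
  proof -
    have "Measurable.pred borel (\<lambda>s. s \<in> A z)"
      using measurable_compose[OF measurable_Pair1'[OF that] A] by simp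
    then show ?thesis by (simp add: pred_def)
  qed
  have "(\<lambda>z. \<integral>\<^sup>+s. indicator (A z) s \<partial>k (\<phi> z)) \<in> borel_measurable M"
  proof (rule measurable_kernel_integral)
    have "(\<lambda>(z, s). indicator (A z) s :: ennreal) = indicator {zs. snd zs \<in> A (fst zs)}"
      by (auto simp: indicator_def)
    moreover have "\<dots> \<in> borel_measurable (M \<Otimes>\<^sub>M borel)"
      using A by (intro borel_measurable_indicator') (simp add: pred_def case_prod_unfold)
    ultimately show "(\<lambda>(z, s). indicator (A z) s :: ennreal) \<in> borel_measurable (M \<Otimes>\<^sub>M borel)"
      by simp
  qed fact
  then show ?thesis
    by (rule measurable_cong[THEN iffD1, rotated])
       (simp add: A' sets_k measurable_space[OF assms(1)])
qed

lemma measurable_cov [measurable]: "Measurable.pred (\<Omega> \<Otimes>\<^sub>M borel) (\<lambda>z. cov (fst z) (snd z))"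
proof -
  have [measurable]: "(\<lambda>z. emeasure (k (shift (snd z) (fst z))) {q - snd z<..<q' - snd z}) \<in> borel_measurable (\<Omega> \<Otimes>\<^sub>M borel)"
    and [measurable]: "(\<lambda>z. emeasure (k (fst z)) {q<..<q'}) \<in> borel_measurable (\<Omega> \<Otimes>\<^sub>M borel)" for q q'
    by (rule measurable_emeasure_k; simp; measurable)+
  have "Measurable.pred (\<Omega> \<Otimes>\<^sub>M borel) (\<lambda>z. \<forall>i j :: rat.
      emeasure (k (shift (snd z) (fst z))) {of_rat i - snd z<..<of_rat j - snd z} =
      emeasure (k (fst z)) {of_rat i<..<of_rat j})"
    by measurable
  then show ?thesis
    by (rule measurable_cong[THEN iffD1, rotated])
       (auto simp: space_pair_measure cov_rational Rats_def)
qed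

lemma measurable_cov' [measurable (raw)]:
  assumes [measurable]: "f \<in> M \<rightarrow>\<^sub>M \<Omega>" "g \<in> borel_measurable M"
  shows "Measurable.pred M (\<lambda>z. cov (f z) (g z))"
  using measurable_compose[OF _ measurable_cov, of "\<lambda>z. (f z, g z)" M] by simp

lemma AE_P0_cov: "AE \<omega> in P0. cov (lift x \<omega>) t"
proof -
  have img: "(\<lambda>s. s - t) ` {q<..<q'} = {q - t<..<q' - t}" for q q' :: real
    using image_diff_atLeastAtMost by (auto simp: image_iff intro!: bexI[of _ "_ + t"])
  have "AE \<omega> in P0. \<forall>q\<in>\<rat>. \<forall>q'\<in>\<rat>.
      emeasure (k (shift t (lift x \<omega>))) {q - t<..<q' - t} = emeasure (k (lift x \<omega>)) {q<..<q'}"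
  proof (intro AE_ball_countable' countable_rat)
    fix q q' :: real
    show "AE \<omega> in P0. emeasure (k (shift t (lift x \<omega>))) {q - t<..<q' - t} = emeasure (k (lift x \<omega>)) {q<..<q'}"
      using covariant[of "{q<..<q'}" t x] by (simp add: img)
  qed
  with AE_space show ?thesis
    by eventually_elim (simp add: cov_rational lift_in_Omega space_P0)
qed

lemma lift_0: "lift 0 \<omega> = \<omega>"
  by (simp add: lift_def)

text \<open>Null sets attached to single times t cannot be united over all real t, but Fubini gives
  almost every t for almost every path. This is a property of the path alone, hence open to
  \<open>palm_AE\<close>.\<close>

definition cov_ae :: "path \<Rightarrow> bool" where
  "cov_ae \<omega> \<longleftrightarrow> (AE t in lborel. cov \<omega> t)"

lemma measurable_cov_ae [measurable]: "Measurable.pred \<Omega> cov_ae"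
proof -
  have [measurable]: "(\<lambda>(\<omega>, t). indicator {t. \<not> cov \<omega> t} t :: ennreal) \<in> borel_measurable (\<Omega> \<Otimes>\<^sub>M lborel)"
  proof -
    have "(\<lambda>(\<omega>, t). indicator {t. \<not> cov \<omega> t} t :: ennreal) = indicator {z. \<not> cov (fst z) (snd z)}"
      by (auto simp: indicator_def)
    moreover have "\<dots> \<in> borel_measurable (\<Omega> \<Otimes>\<^sub>M lborel)"
      by (rule borel_measurable_indicator') measurable
    ultimately show ?thesis by simp
  qed
  have "Measurable.pred \<Omega> (\<lambda>\<omega>. (\<integral>\<^sup>+t. indicator {t. \<not> cov \<omega> t} t \<partial>lborel) = 0)"
    by measurable
  then show ?thesis
  proof (rule measurable_cong[THEN iffD1, rotated])
    fix \<omega> assume "\<omega> \<in> space \<Omega>"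
    then have "Measurable.pred borel (\<lambda>t. cov \<omega> t)" by measurable
    then show "((\<integral>\<^sup>+t. indicator {t. \<not> cov \<omega> t} t \<partial>lborel) = 0) = cov_ae \<omega>"
      unfolding cov_ae_def by (subst AE_iff_nn_integral) (simp_all add: pred_def)
  qed
qed

lemma AE_P0_cov_ae: "AE \<omega> in P0. cov_ae (lift x \<omega>)"
proof -
  have "{z \<in> space (lborel \<Otimes>\<^sub>M P0). cov (lift x (snd z)) (fst z)} \<in> sets (lborel \<Otimes>\<^sub>M P0)"
    by measurable
  from AE_commute[OF this] show ?thesis
    unfolding cov_ae_def using AE_P0_cov by simp
qed

text \<open>A cocycle argument: almost every t is good both for the step from \<omega> to
  \<open>shift (s + t) \<omega>\<close> and for the step from \<open>shift s \<omega>\<close> to the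
  same path. Any such t is a detour joining \<open>shift s \<omega>\<close> to \<omega>, however
  exceptional s may be.\<close>

lemma cov_ae_shift:
  assumes \<omega>: "\<omega> \<in> space \<Omega>" and 1: "cov_ae \<omega>" and 2: "cov_ae (shift s \<omega>)"
  shows "cov \<omega> s"
proof -
  have "Measurable.pred borel (\<lambda>t. cov \<omega> t)" using \<omega> by measurable
  with 1 have "AE t in lborel. cov \<omega> (s + 1 * t)"
    unfolding cov_ae_def by (intro AE_borel_affine) auto
  moreover have "AE t in lborel. cov (shift s \<omega>) t" using 2 by (simp add: cov_ae_def)
  ultimately have "AE t in lborel. cov \<omega> (s + t) \<and> cov (shift s \<omega>) t"
    by eventually_elim simp
  moreover have "ae_filter lborel \<noteq> (bot :: real filter)" by (simp add: ae_filter_eq_bot_iff)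
  ultimately obtain t where t: "cov \<omega> (s + t)" "cov (shift s \<omega>) t"
    using eventually_happens by blast
  have "emeasure (k (shift s \<omega>)) {a - s<..<b - s} = emeasure (k \<omega>) {a<..<b}" for a b
  proof -
    have "emeasure (k (shift s \<omega>)) {a - s<..<b - s} = emeasure (k (shift t (shift s \<omega>))) {a - s - t<..<b - s - t}"
      using t(2) by (simp add: cov_def)
    also have "\<dots> = emeasure (k (shift (s + t) \<omega>)) {a - (s + t)<..<b - (s + t)}"
      by (simp add: shift_shift diff_diff_eq)
    also have "\<dots> = emeasure (k \<omega>) {a<..<b}" using t(1) by (simp add: cov_def)
    finally show ?thesis .
  qed
  then show ?thesis by (simp add: cov_def)
qed

text \<open>The hypotheses give covariance only for Lebesgue-almost every shift, while the mass transport
  needs it at almost every point of the local time, a Lebesgue-null set. The Palm formula bridges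
  the two: such points inherit every almost sure property of the Brownian path at time zero.\<close>

lemma AE_Q_cov_kernel: "AE \<omega> in Q. AE s in k \<omega>. cov \<omega> s"
proof -
  have "AE \<omega> in P0. cov_ae \<omega>" using AE_P0_cov_ae[of 0] by (simp add: lift_0)
  then have "AE \<omega> in Q. AE s in k \<omega>. cov_ae (shift s \<omega>)" by (subst (asm) palm_AE) measurable
  moreover have "AE \<omega> in Q. cov_ae \<omega>" by (rule AE_Q) (auto intro: AE_P0_cov_ae)
  ultimately show ?thesis
    using AE_space
  proof eventually_elim
    case (elim \<omega>)
    from elim(1) show ?case
      by eventually_elim (rule cov_ae_shift, use elim in \<open>auto simp: space_Q\<close>)
  qed
qed

section \<open>Chebyshev's bound and the absence of wandering sets under \<open>Q\<close>\<close>

lemma prob_abs_ge: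
  assumes t: "0 < t" and c: "0 < c"
  shows "emeasure P0 {\<omega> \<in> space P0. c \<le> \<bar>\<omega> t\<bar>} \<le> ennreal (t / c\<^sup>2)"
proof -
  let ?X = "\<lambda>\<omega>::path. \<omega> t - \<omega> 0"
  have D: "distributed P0 lborel ?X (normal_density 0 (sqrt t))"
    using BM t by (force simp: two_sided_standard_BM_def)
  have "integrable P0 (\<lambda>\<omega>. ?X \<omega> ^ 2)"
    using integrable_normal_moment[of "sqrt t" 0 2] t
    by (subst distributed_integrable[OF D, of "\<lambda>x. x^2", symmetric]) auto
  from P0.Chebyshev_inequality[OF _ this c]
  have "P0.prob {\<omega> \<in> space P0. c \<le> \<bar>?X \<omega>\<bar>} \<le> t / c\<^sup>2"
    using P0.normal_distributed_expectation[OF _ D] P0.normal_distributed_variance[OF _ D] t by simp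
  then have "emeasure P0 {\<omega> \<in> space P0. c \<le> \<bar>?X \<omega>\<bar>} \<le> ennreal (t / c\<^sup>2)"
    by (simp add: P0.emeasure_eq_measure ennreal_leI)
  moreover have "emeasure P0 {\<omega> \<in> space P0. c \<le> \<bar>\<omega> t\<bar>} = emeasure P0 {\<omega> \<in> space P0. c \<le> \<bar>?X \<omega>\<bar>}"
  proof (rule emeasure_eq_AE)
    have "AE \<omega> in P0. \<omega> 0 = 0" using BM by (simp add: two_sided_standard_BM_def)
    then show "AE \<omega> in P0. \<omega> \<in> {\<omega> \<in> space P0. c \<le> \<bar>\<omega> t\<bar>} \<longleftrightarrow> \<omega> \<in> {\<omega> \<in> space P0. c \<le> \<bar>?X \<omega>\<bar>}"
      by eventually_elim simp
  qed simp_all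
  ultimately show ?thesis by simp
qed

lemma nn_integral_Q_indicator:
  assumes [measurable]: "B \<in> sets borel"
  shows "(\<integral>\<^sup>+\<omega>. indicator B (\<omega> 0) \<partial>Q) = emeasure lborel B"
proof -
  have "(\<integral>\<^sup>+\<omega>. indicator B (\<omega> 0) \<partial>Q) = (\<integral>\<^sup>+x. \<integral>\<^sup>+\<omega>. indicator B (lift x \<omega> 0) \<partial>P0 \<partial>lborel)"
    by (rule nn_integral_Q) measurable
  also have "\<dots> = (\<integral>\<^sup>+x. \<integral>\<^sup>+\<omega>. indicator B x \<partial>P0 \<partial>lborel)"
  proof (rule nn_integral_cong, rule nn_integral_cong_AE)
    fix x
    have "AE \<omega> in P0. \<omega> 0 = 0" using BM by (simp add: two_sided_standard_BM_def)
    then show "AE \<omega> in P0. indicator B (lift x \<omega> 0) = (indicator B x :: ennreal)"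
      by eventually_elim (simp add: lift_def)
  qed
  also have "\<dots> = emeasure lborel B" by (simp add: P0.emeasure_space_1)
  finally show ?thesis .
qed

text \<open>The value at time 0 has Lebesgue distribution under \<open>Q\<close>, so the slabs have
  mass 2j. This is what allows Fubini between \<open>Q\<close> and Lebesgue time.\<close>

sublocale Q: sigma_finite_measure Q
proof
  let ?A = "range (\<lambda>j::nat. {\<omega> \<in> space Q. \<omega> 0 \<in> {-real j<..<real j}})"
  have [measurable]: "(\<lambda>\<omega>. \<omega> t :: real) \<in> borel_measurable Q" for t by simp
  have "emeasure Q {\<omega> \<in> space Q. \<omega> 0 \<in> {-real j<..<real j}} \<noteq> \<infinity>" for j
  proof -
    have "emeasure Q {\<omega> \<in> space Q. \<omega> 0 \<in> {-real j<..<real j}} = (\<integral>\<^sup>+\<omega>. indicator {-real j<..<real j} (\<omega> 0) \<partial>Q)"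
      by (subst nn_integral_indicator[symmetric], measurable)
         (auto intro!: nn_integral_cong split: split_indicator)
    then show ?thesis by (simp add: nn_integral_Q_indicator)
  qed
  moreover have "\<Union>?A = space Q"
  proof -
    have "\<exists>j. - real j < x \<and> x < real j" for x
    proof -
      obtain j where "\<bar>x\<bar> < real j" using reals_Archimedean2 by blast
      then show ?thesis by (intro exI[of _ j]) linarith
    qed
    then show ?thesis by auto
  qed
  moreover have "?A \<subseteq> sets Q"
  proof -
    have "{\<omega> \<in> space Q. \<omega> 0 \<in> {-real j<..<real j}} \<in> sets Q" for j by measurable
    then show ?thesis by blast
  qed
  ultimately show "\<exists>A. countable A \<and> A \<subseteq> sets Q \<and> \<Union>A = space Q \<and> (\<forall>a\<in>A. emeasure Q a \<noteq> \<infinity>)"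
    by (intro exI[of _ ?A]) auto
qed

text \<open>Up to time \<open>t\<close> the path stays within \<open>t\<^sup>3\<^sup>/\<^sup>4\<close>, a region of small \<open>Q\<close>-measure compared
  to \<open>t\<close>; a wandering set of positive measure would contradict the shift invariance of \<open>Q\<close>.\<close>

lemma wandering_null:
  assumes W [measurable]: "W \<in> sets \<Omega>"
    and wander: "AE \<omega> in Q. (\<integral>\<^sup>+t. indicator W (shift (- t) \<omega>) \<partial>lborel) \<le> 1"
  shows "AE \<omega> in Q. \<omega> \<notin> W"
proof -
  have ev [measurable]: "(\<lambda>\<omega>. \<omega> t :: real) \<in> borel_measurable Q" for t by simp
  have bound: "emeasure Q {\<omega> \<in> space Q. \<omega> \<in> W \<and> \<bar>\<omega> 0\<bar> \<le> real a} \<le> ennreal ((4 * real a + 2) / real (Suc m))"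
    (is "?M \<le> _") for a m :: nat
  proof -
    \<comment> \<open>The horizon is n^4 and the displacement n^3: at a fixed time before the
      horizon Chebyshev gives probability at most n^4/n^6 = 1/n^2, while a slab of half-width
      \<open>R\<close> has mass of order n^3, small against the horizon.\<close>
    define n where "n = real (Suc m)"
    have n: "1 \<le> n" by (simp add: n_def)
    define R where "R = real a + n ^ 3"
    have R: "0 \<le> R" using n by (simp add: R_def)
    \<comment> \<open>The mass of W lying in the slab at time t. Shift invariance moves the slab
      condition to time 0; as an orbit spends total time at most 1 in W, the time integral of
      \<alpha> is at most the mass 2R of the slab.\<close>
    define \<alpha> where "\<alpha> t = (\<integral>\<^sup>+\<omega>. indicator W \<omega> * indicator {-R<..<R} (\<omega> t) \<partial>Q)" for t :: real
    have \<alpha>_eq: "\<alpha> t = (\<integral>\<^sup>+\<omega>. indicator W (shift (- t) \<omega>) * indicator {-R<..<R} (\<omega> 0) \<partial>Q)" for t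
    proof -
      have "\<alpha> t = (\<integral>\<^sup>+\<omega>. (\<lambda>\<omega>. indicator W (shift (- t) \<omega>) * indicator {-R<..<R} (\<omega> 0)) (shift t \<omega>) \<partial>Q)"
        by (simp add: \<alpha>_def shift_shift) (simp add: shift_def)
      also have "\<dots> = (\<integral>\<^sup>+\<omega>. indicator W (shift (- t) \<omega>) * indicator {-R<..<R} (\<omega> 0) \<partial>Q)"
        by (rule nn_integral_Q_shift) measurable
      finally show ?thesis .
    qed
    have QR: "(\<integral>\<^sup>+\<omega>. indicator {-R<..<R} (\<omega> 0) \<partial>Q) = ennreal (2 * R)"
      using R by (simp add: nn_integral_Q_indicator)
    have \<alpha>_meas [measurable]: "\<alpha> \<in> borel_measurable borel"
      unfolding \<alpha>_eq[abs_def] by (rule Q.borel_measurable_nn_integral) measurable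
    have \<alpha>_int: "(\<integral>\<^sup>+t. \<alpha> t \<partial>lborel) \<le> ennreal (2 * R)"
    proof -
      interpret QL: pair_sigma_finite Q lborel ..
      have "(\<integral>\<^sup>+t. \<alpha> t \<partial>lborel) = (\<integral>\<^sup>+t. \<integral>\<^sup>+\<omega>. indicator W (shift (- t) \<omega>) * indicator {-R<..<R} (\<omega> 0) \<partial>Q \<partial>lborel)"
        by (simp add: \<alpha>_eq)
      also have "\<dots> = (\<integral>\<^sup>+\<omega>. \<integral>\<^sup>+t. indicator W (shift (- t) \<omega>) * indicator {-R<..<R} (\<omega> 0) \<partial>lborel \<partial>Q)"
        by (rule QL.Fubini') measurable
      also have "\<dots> = (\<integral>\<^sup>+\<omega>. (\<integral>\<^sup>+t. indicator W (shift (- t) \<omega>) \<partial>lborel) * indicator {-R<..<R} (\<omega> 0) \<partial>Q)"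
        by (intro nn_integral_cong nn_integral_multc) (simp add: space_Q)
      also have "\<dots> \<le> (\<integral>\<^sup>+\<omega>. 1 * indicator {-R<..<R} (\<omega> 0) \<partial>Q)"
      proof (rule nn_integral_mono_AE)
        show "AE \<omega> in Q. (\<integral>\<^sup>+t. indicator W (shift (- t) \<omega>) \<partial>lborel) * indicator {-R<..<R} (\<omega> 0)
            \<le> (1 * indicator {-R<..<R} (\<omega> 0) :: ennreal)"
          using wander by eventually_elim (rule mult_right_mono, simp_all)
      qed
      finally show ?thesis by (simp add: QR)
    qed
    \<comment> \<open>A path of the event is in the slab at time t or has moved by at least n^3; the
      starting points of modulus at most a contribute the factor 2a.\<close>
    have \<beta>: "?M \<le> \<alpha> t + ennreal (2 * real a * (n ^ 4 / (n ^ 3)\<^sup>2))" if t: "0 < t" "t \<le> n ^ 4" for t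
    proof -
      have "?M = (\<integral>\<^sup>+\<omega>. indicator {\<omega> \<in> space Q. \<omega> \<in> W \<and> \<bar>\<omega> 0\<bar> \<le> real a} \<omega> \<partial>Q)"
        by (rule nn_integral_indicator[symmetric]) measurable
      also have "\<dots> \<le> (\<integral>\<^sup>+\<omega>. indicator W \<omega> * indicator {-R<..<R} (\<omega> t) +
          indicator {-real a..real a} (\<omega> 0) * indicator (- {-R<..<R}) (\<omega> t) \<partial>Q)"
        by (intro nn_integral_mono) (auto split: split_indicator)
      also have "\<dots> = \<alpha> t + (\<integral>\<^sup>+\<omega>. indicator {-real a..real a} (\<omega> 0) * indicator (- {-R<..<R}) (\<omega> t) \<partial>Q)"
        unfolding \<alpha>_def by (rule nn_integral_add) measurable
      also have "(\<integral>\<^sup>+\<omega>. indicator {-real a..real a} (\<omega> 0) * indicator (- {-R<..<R}) (\<omega> t) \<partial>Q) =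
          (\<integral>\<^sup>+x. \<integral>\<^sup>+\<omega>. indicator {-real a..real a} (lift x \<omega> 0) * indicator (- {-R<..<R}) (lift x \<omega> t) \<partial>P0 \<partial>lborel)"
        by (rule nn_integral_Q) measurable
      also have "\<dots> \<le> (\<integral>\<^sup>+x. ennreal (n ^ 4 / (n ^ 3)\<^sup>2) * indicator {-real a..real a} x \<partial>lborel)"
      proof (rule nn_integral_mono)
        fix x
        have "(\<integral>\<^sup>+\<omega>. indicator {-real a..real a} (lift x \<omega> 0) * indicator (- {-R<..<R}) (lift x \<omega> t) \<partial>P0) \<le>
            (\<integral>\<^sup>+\<omega>. indicator {-real a..real a} x * indicator {\<omega> \<in> space P0. n ^ 3 \<le> \<bar>\<omega> t\<bar>} \<omega> \<partial>P0)"
        proof (rule nn_integral_mono_AE)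
          have "AE \<omega> in P0. \<omega> 0 = 0" using BM by (simp add: two_sided_standard_BM_def)
          with AE_space show "AE \<omega> in P0. indicator {-real a..real a} (lift x \<omega> 0) * indicator (- {-R<..<R}) (lift x \<omega> t)
              \<le> (indicator {-real a..real a} x * indicator {\<omega> \<in> space P0. n ^ 3 \<le> \<bar>\<omega> t\<bar>} \<omega> :: ennreal)"
            by eventually_elim (auto simp: lift_def R_def split: split_indicator)
        qed
        also have "\<dots> = indicator {-real a..real a} x * emeasure P0 {\<omega> \<in> space P0. n ^ 3 \<le> \<bar>\<omega> t\<bar>}"
          by (subst nn_integral_cmult) simp_all
        also have "\<dots> \<le> indicator {-real a..real a} x * ennreal (n ^ 4 / (n ^ 3)\<^sup>2)"
        proof (rule mult_left_mono)
          have "emeasure P0 {\<omega> \<in> space P0. n ^ 3 \<le> \<bar>\<omega> t\<bar>} \<le> ennreal (t / (n ^ 3)\<^sup>2)"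
            using n t by (intro prob_abs_ge) auto
          also have "\<dots> \<le> ennreal (n ^ 4 / (n ^ 3)\<^sup>2)"
            using t by (intro ennreal_leI divide_right_mono) auto
          finally show "emeasure P0 {\<omega> \<in> space P0. n ^ 3 \<le> \<bar>\<omega> t\<bar>} \<le> ennreal (n ^ 4 / (n ^ 3)\<^sup>2)" .
        qed simp
        finally show "(\<integral>\<^sup>+\<omega>. indicator {-real a..real a} (lift x \<omega> 0) * indicator (- {-R<..<R}) (lift x \<omega> t) \<partial>P0)
            \<le> ennreal (n ^ 4 / (n ^ 3)\<^sup>2) * indicator {-real a..real a} x"
          by (simp add: mult.commute)
      qed
      also have "\<dots> = ennreal (2 * real a * (n ^ 4 / (n ^ 3)\<^sup>2))"
        using n by (subst nn_integral_cmult_indicator) (simp_all add: ennreal_mult'[symmetric] mult.commute)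
      finally show ?thesis by simp
    qed
    have "?M * ennreal (n ^ 4) = (\<integral>\<^sup>+t. ?M * indicator {0<..n ^ 4} t \<partial>lborel)"
      using n by (subst nn_integral_cmult_indicator) simp_all
    also have "\<dots> \<le> (\<integral>\<^sup>+t. \<alpha> t + ennreal (2 * real a * (n ^ 4 / (n ^ 3)\<^sup>2)) * indicator {0<..n ^ 4} t \<partial>lborel)"
      using \<beta> by (intro nn_integral_mono) (auto split: split_indicator)
    also have "\<dots> = (\<integral>\<^sup>+t. \<alpha> t \<partial>lborel) + ennreal (2 * real a * (n ^ 4 / (n ^ 3)\<^sup>2)) * ennreal (n ^ 4)"
      using n by (subst nn_integral_add) (simp_all add: nn_integral_cmult_indicator)
    also have "\<dots> \<le> ennreal (2 * R) + ennreal (2 * real a * (n ^ 4 / (n ^ 3)\<^sup>2)) * ennreal (n ^ 4)"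
      by (intro add_right_mono \<alpha>_int)
    also have "\<dots> = ennreal (2 * R + 2 * real a * (n ^ 4 / (n ^ 3)\<^sup>2) * n ^ 4)"
      using R n by (simp add: ennreal_mult'[symmetric] ennreal_plus[symmetric] del: ennreal_plus)
    also have "\<dots> \<le> ennreal ((4 * real a + 2) / n * n ^ 4)"
    \<comment> \<open>The sum is 2a + 2n^3 + 2a n^2; bounding 1 and n^2 by n^3 gives (4a + 2)
      n^3.\<close>
    proof (rule ennreal_leI)
      have "n ^ 4 / (n ^ 3)\<^sup>2 * n ^ 4 = n ^ 2" using n by (simp add: field_simps flip: power_mult power_add)
      then have 1: "2 * real a * (n ^ 4 / (n ^ 3)\<^sup>2) * n ^ 4 = 2 * real a * n ^ 2"
        by (simp only: mult.assoc)
      have 2: "(4 * real a + 2) / n * n ^ 4 = (4 * real a + 2) * n ^ 3"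
        using n by (simp add: field_simps power_numeral_reduce)
      have le: "n ^ 2 \<le> n ^ 3" "1 \<le> n ^ 3" using n by (auto intro: power_increasing)
      have "real a * n ^ 2 \<le> real a * n ^ 3" "real a * 1 \<le> real a * n ^ 3"
        using le[THEN mult_left_mono[OF _ of_nat_0_le_iff]] by blast+
      then show "2 * R + 2 * real a * (n ^ 4 / (n ^ 3)\<^sup>2) * n ^ 4 \<le> (4 * real a + 2) / n * n ^ 4"
        unfolding R_def 1 2 by (simp add: algebra_simps)
    qed
    also have "\<dots> = ennreal ((4 * real a + 2) / n) * ennreal (n ^ 4)"
      using n by (intro ennreal_mult) auto
    finally have "?M * ennreal (n ^ 4) \<le> ennreal ((4 * real a + 2) / n) * ennreal (n ^ 4)" .
    then have "ennreal (n ^ 4) * ?M \<le> ennreal (n ^ 4) * ennreal ((4 * real a + 2) / n)"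
      by (simp only: mult.commute)
    moreover have "ennreal (n ^ 4) \<noteq> 0" using n by simp
    ultimately show ?thesis unfolding n_def by (subst (asm) ennreal_mult_le_mult_iff) auto
  qed
  have "AE \<omega> in Q. \<not> (\<omega> \<in> W \<and> \<bar>\<omega> 0\<bar> \<le> real a)" for a
  proof -
    have "(\<lambda>m. ennreal ((4 * real a + 2) / real (Suc m))) \<longlonglongrightarrow> ennreal 0"
      using tendsto_mult_right_zero[OF LIMSEQ_inverse_real_of_nat, of "4 * real a + 2"]
      by (intro tendsto_ennrealI) (simp add: divide_inverse)
    then have "emeasure Q {\<omega> \<in> space Q. \<omega> \<in> W \<and> \<bar>\<omega> 0\<bar> \<le> real a} \<le> ennreal 0"
      by (rule LIMSEQ_le_const) (use bound in blast)
    moreover have "{\<omega> \<in> space Q. \<omega> \<in> W \<and> \<bar>\<omega> 0\<bar> \<le> real a} \<in> sets Q" by measurable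
    ultimately show ?thesis
      by (intro AE_I[where N="{\<omega> \<in> space Q. \<omega> \<in> W \<and> \<bar>\<omega> 0\<bar> \<le> real a}"]) (auto simp: zero_ennreal_def[symmetric])
  qed
  then have "AE \<omega> in Q. \<forall>a::nat. \<not> (\<omega> \<in> W \<and> \<bar>\<omega> 0\<bar> \<le> real a)"
    unfolding AE_all_countable by (rule allI)
  then show ?thesis
    by eventually_elim (meson real_arch_simple)
qed

end

subsection \<open>Invariance under the inverse local time\<close>

lemma AE_zero_measure: "emeasure M (space M) = 0 \<Longrightarrow> AE x in M. P x"
  by (rule AE_I[of _ _ "space M"]) auto

text \<open>The unit interval starting at the infimum of a nonempty S contains S.\<close>

lemma nn_integral_indicator_diameter:
  fixes S :: "real set"
  assumes "\<And>t t'. t \<in> S \<Longrightarrow> t' \<in> S \<Longrightarrow> t' - t \<le> 1"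
  shows "(\<integral>\<^sup>+t. indicator S t \<partial>lborel) \<le> 1"
proof (cases "S = {}")
  case False
  then obtain t0 where t0: "t0 \<in> S" by auto
  have bdd: "bdd_below S" by (rule bdd_belowI[of _ "t0 - 1"]) (use assms[OF _ t0] in force)
  have "S \<subseteq> {Inf S..Inf S + 1}"
  proof
    fix t assume t: "t \<in> S"
    have "t - 1 \<le> Inf S" using False assms[OF _ t] by (intro cInf_greatest) force+
    with cInf_lower[OF t bdd] show "t \<in> {Inf S..Inf S + 1}" by simp
  qed
  then have "(\<integral>\<^sup>+t. indicator S t \<partial>lborel) \<le> (\<integral>\<^sup>+t. indicator {Inf S..Inf S + 1} t \<partial>lborel)"
    by (intro nn_integral_mono) (auto split: split_indicator)
  then show ?thesis by simp
qed simp

text \<open>A finite tail decreases to zero, so it drops below every positive level, and stays there for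
  all earlier starting points by the absence of level crossings.\<close>

lemma tail_vanishes:
  fixes A :: "int \<Rightarrow> real set" and \<mu> :: "real measure"
  assumes A: "\<And>i. A i \<in> sets \<mu>" "\<And>i. A (i + 1) \<subseteq> A i" "(\<Inter>n. A (int n)) = {}" "(\<Union>n. A (- int n)) = UNIV"
    and fin: "emeasure \<mu> (A 0) < \<infinity>"
    and no_crossing: "\<And>i m. \<not> (emeasure \<mu> (A i) \<le> ennreal (inverse (real (Suc m))) \<and>
      ennreal (inverse (real (Suc m))) < emeasure \<mu> (A (i - 1)))"
  shows "emeasure \<mu> UNIV = 0"
proof -
  have anti: "A j \<subseteq> A i" if "i \<le> j" for i j
    using that by (induction j rule: int_ge_induct) (use A(2) in \<open>auto 4 3\<close>)
  have "emeasure \<mu> UNIV \<le> ennreal (inverse (real (Suc m)))" for m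
  proof -
    let ?c = "ennreal (inverse (real (Suc m)))"
    have "(\<lambda>n. emeasure \<mu> (A (int n))) \<longlonglongrightarrow> emeasure \<mu> (\<Inter>n. A (int n))"
    proof (rule Lim_emeasure_decseq)
      show "decseq (\<lambda>n. A (int n))" unfolding decseq_def by (intro allI impI anti) simp
      show "emeasure \<mu> (A (int n)) \<noteq> \<infinity>" for n
        using emeasure_mono[OF anti[of 0 "int n"] A(1)] fin by (auto simp: top_unique)
    qed (use A(1) in auto)
    then have "(\<lambda>n. emeasure \<mu> (A (int n))) \<longlonglongrightarrow> 0" by (simp add: A(3))
    moreover have "0 < ?c" by simp
    ultimately have "eventually (\<lambda>n. emeasure \<mu> (A (int n)) < ?c) sequentially"
      by (rule order_tendstoD)
    then obtain n where "emeasure \<mu> (A (int n)) < ?c"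
      unfolding eventually_sequentially by blast
    then have n: "emeasure \<mu> (A (int n)) \<le> ?c" by (rule less_imp_le)
    have le: "emeasure \<mu> (A j) \<le> ?c" if "j \<le> int n" for j
      using that
    proof (induction j rule: int_le_induct)
      case (step i)
      then show ?case using no_crossing[of i m] by (simp add: not_less)
    qed (rule n)
    have "emeasure \<mu> UNIV = emeasure \<mu> (\<Union>i. A (- int i))"
      by (simp only: A(4))
    also have "\<dots> = (SUP i. emeasure \<mu> (A (- int i)))"
    proof (rule SUP_emeasure_incseq[symmetric])
      show "incseq (\<lambda>i. A (- int i))" unfolding incseq_def by (intro allI impI anti) simp
    qed (use A(1) in auto)
    also have "\<dots> \<le> ?c" by (intro SUP_least le) simp
    finally show ?thesis .
  qed
  moreover have "(\<lambda>m. ennreal (inverse (real (Suc m)))) \<longlonglongrightarrow> ennreal 0"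
    by (intro tendsto_ennrealI LIMSEQ_inverse_real_of_nat)
  ultimately have "emeasure \<mu> UNIV \<le> ennreal 0"
    using LIMSEQ_le_const by blast
  then show ?thesis by simp
qed

context brownian_kernel
begin

text \<open>Open intervals form a generator closed under intersection, and the windows (-n, n) have
  finite mass, so agreement on intervals is agreement of measures.\<close>

lemma cov_emeasure:
  assumes \<omega>: "\<omega> \<in> space \<Omega>" and cov: "cov \<omega> t" and A: "A \<in> sets borel"
  shows "emeasure (k (shift t \<omega>)) {u. u + t \<in> A} = emeasure (k \<omega>) A"
proof -
  have "k \<omega> = distr (k (shift t \<omega>)) borel (\<lambda>u. u + t)" (is "_ = ?D")
  proof (rule measure_eqI_generator_eq)
    let ?E = "range (\<lambda>(a, b). {a<..<b::real})"
    show "Int_stable ?E" by (auto simp: Int_stable_def)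
    show "?E \<subseteq> Pow UNIV" by simp
    show "sets (k \<omega>) = sigma_sets UNIV ?E"
      unfolding sets_k[OF \<omega>] borel_eq_box by (simp add: box_real[abs_def] case_prod_unfold)
    then show "sets ?D = sigma_sets UNIV ?E"
      using sets_k[OF \<omega>] by simp
    show "range (\<lambda>n. {-real n<..<real n}) \<subseteq> ?E" by auto
    show "(\<Union>n. {-real n<..<real n}) = UNIV"
    proof -
      have "\<exists>n. - real n < x \<and> x < real n" for x
      proof -
        obtain n where "\<bar>x\<bar> < real n" using reals_Archimedean2 by blast
        then show ?thesis by (intro exI[of _ n]) linarith
      qed
      then show ?thesis by auto
    qed
    show "emeasure (k \<omega>) {-real n<..<real n} \<noteq> \<infinity>" for n
    proof -
      have "emeasure (k \<omega>) {-real n<..<real n} \<le> emeasure (k \<omega>) {-real n..real n}"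
        by (intro emeasure_mono) (auto simp: sets_k[OF \<omega>])
      also have "\<dots> < \<infinity>" by (rule finite_k[OF \<omega>])
      finally show ?thesis by simp
    qed
    fix X assume "X \<in> ?E"
    then obtain a b where X: "X = {a<..<b}" by auto
    have "(\<lambda>u. u + t) -` {a<..<b} = {a - t<..<b - t}" by auto
    moreover have "(\<lambda>u. u + t) \<in> k (shift t \<omega>) \<rightarrow>\<^sub>M borel"
      by (simp add: measurable_k_iff shift_in_Omega \<omega>)
    ultimately show "emeasure (k \<omega>) X = emeasure ?D X"
      using cov by (simp add: X emeasure_distr cov_def space_k shift_in_Omega \<omega>)
  qed
  moreover have "(\<lambda>u. u + t) \<in> k (shift t \<omega>) \<rightarrow>\<^sub>M borel"
    by (simp add: measurable_k_iff shift_in_Omega \<omega>)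
  ultimately have "emeasure (k \<omega>) A = emeasure (k (shift t \<omega>)) ((\<lambda>u. u + t) -` A \<inter> space (k (shift t \<omega>)))"
    using A by (metis emeasure_distr)
  then show ?thesis by (simp add: space_k shift_in_Omega \<omega> vimage_def)
qed

lemma cov_Ioi: "\<omega> \<in> space \<Omega> \<Longrightarrow> cov \<omega> t \<Longrightarrow> emeasure (k (shift t \<omega>)) {a<..} = emeasure (k \<omega>) {a + t<..}"
  using cov_emeasure[of \<omega> t "{a + t<..}"] by (simp add: greaterThan_def)

lemma cov_Iio: "\<omega> \<in> space \<Omega> \<Longrightarrow> cov \<omega> t \<Longrightarrow> emeasure (k (shift t \<omega>)) {..<a} = emeasure (k \<omega>) {..<a + t}"
  using cov_emeasure[of \<omega> t "{..<a + t}"] by (simp add: lessThan_def)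

lemma measurable_emeasure_k_const [measurable]:
  "C \<in> sets borel \<Longrightarrow> (\<lambda>\<omega>. emeasure (k \<omega>) C) \<in> borel_measurable \<Omega>"
  by (rule measurable_k)

text \<open>Only the Lebesgue measure of the visiting times along an orbit counts, so covariance at
  almost every time is enough. By the diameter bound this measure is at most 1, and the set where P
  holds is wandering.\<close>

lemma AE_Q_wander:
  assumes P [measurable]: "Measurable.pred \<Omega> P"
    and S: "\<And>\<omega> t t'. \<omega> \<in> space \<Omega> \<Longrightarrow> cov \<omega> (- t) \<Longrightarrow> cov \<omega> (- t') \<Longrightarrow>
      P (shift (- t) \<omega>) \<Longrightarrow> P (shift (- t') \<omega>) \<Longrightarrow> t' - t \<le> 1"
  shows "AE \<omega> in Q. \<not> P \<omega>"
proof -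
  let ?W = "{\<omega> \<in> space \<Omega>. P \<omega>}"
  have "AE \<omega> in Q. cov_ae \<omega>" by (rule AE_Q) (auto intro: AE_P0_cov_ae)
  with AE_space have "AE \<omega> in Q. (\<integral>\<^sup>+t. indicator ?W (shift (- t) \<omega>) \<partial>lborel) \<le> 1"
  proof eventually_elim
    case (elim \<omega>)
    then have \<omega>: "\<omega> \<in> space \<Omega>" by (simp add: space_Q)
    have "Measurable.pred borel (\<lambda>t. cov \<omega> t)" using \<omega> by measurable
    with elim(2) have cov: "AE t in lborel. cov \<omega> (0 + (- 1) * t)"
      unfolding cov_ae_def by (intro AE_borel_affine) auto
    have "(\<integral>\<^sup>+t. indicator ?W (shift (- t) \<omega>) \<partial>lborel) \<le>
        (\<integral>\<^sup>+t. indicator {t. cov \<omega> (- t) \<and> P (shift (- t) \<omega>)} t \<partial>lborel)"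
      by (rule nn_integral_mono_AE) (use cov in \<open>eventually_elim, simp split: split_indicator\<close>)
    also have "\<dots> \<le> 1"
      by (rule nn_integral_indicator_diameter) (use S[OF \<omega>] in blast)
    finally show ?case .
  qed
  then have "AE \<omega> in Q. \<omega> \<notin> ?W"
    by (intro wandering_null) measurable
  with AE_space show ?thesis
    by eventually_elim (simp add: space_Q)
qed

text \<open>Along an orbit the mass to the right of a - t is nondecreasing in t and passes the level
  c only once, so two times at which the crossing falls into the unit window differ by at most 1.
  \<open>AE_Q_left\<close> is the mirror image.\<close>

lemma AE_Q_right:
  "AE \<omega> in Q. \<not> (emeasure (k \<omega>) {a<..} \<le> ennreal c \<and> ennreal c < emeasure (k \<omega>) {a - 1<..})"
proof (rule AE_Q_wander)
  fix \<omega> t t'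
  assume \<omega>: "\<omega> \<in> space \<Omega>" and cov: "cov \<omega> (- t)" "cov \<omega> (- t')"
    and W: "emeasure (k (shift (- t) \<omega>)) {a<..} \<le> ennreal c \<and> ennreal c < emeasure (k (shift (- t) \<omega>)) {a - 1<..}"
      "emeasure (k (shift (- t') \<omega>)) {a<..} \<le> ennreal c \<and> ennreal c < emeasure (k (shift (- t') \<omega>)) {a - 1<..}"
  show "t' - t \<le> 1"
  proof (rule ccontr)
    assume "\<not> t' - t \<le> 1"
    then have "emeasure (k \<omega>) {a - 1 + - t<..} \<le> emeasure (k \<omega>) {a + - t'<..}"
      by (intro emeasure_mono) (auto simp: sets_k \<omega>)
    with W show False unfolding cov_Ioi[OF \<omega> cov(1)] cov_Ioi[OF \<omega> cov(2)] by (elim conjE) order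
  qed
qed measurable

lemma AE_Q_left:
  "AE \<omega> in Q. \<not> (emeasure (k \<omega>) {..<a} \<le> ennreal c \<and> ennreal c < emeasure (k \<omega>) {..<a + 1})"
proof (rule AE_Q_wander)
  fix \<omega> t t'
  assume \<omega>: "\<omega> \<in> space \<Omega>" and cov: "cov \<omega> (- t)" "cov \<omega> (- t')"
    and W: "emeasure (k (shift (- t) \<omega>)) {..<a} \<le> ennreal c \<and> ennreal c < emeasure (k (shift (- t) \<omega>)) {..<a + 1}"
      "emeasure (k (shift (- t') \<omega>)) {..<a} \<le> ennreal c \<and> ennreal c < emeasure (k (shift (- t') \<omega>)) {..<a + 1}"
  show "t' - t \<le> 1"
  proof (rule ccontr)
    assume "\<not> t' - t \<le> 1"
    then have "emeasure (k \<omega>) {..<a + 1 + - t'} \<le> emeasure (k \<omega>) {..<a + - t}"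
      by (intro emeasure_mono) (auto simp: sets_k \<omega>)
    with W show False unfolding cov_Iio[OF \<omega> cov(1)] cov_Iio[OF \<omega> cov(2)] by (elim conjE) order
  qed
qed measurable

text \<open>Integer endpoints and levels 1/(m+1) make the no-crossing statements countable, and then
  a finite tail forces total mass 0. That alternative is harmless later: such a path contributes no
  point to the Palm formula.\<close>

lemma AE_Q_infinite:
  "AE \<omega> in Q. emeasure (k \<omega>) UNIV = 0 \<or>
     emeasure (k \<omega>) {0<..} = \<infinity> \<and> emeasure (k \<omega>) {..<0} = \<infinity>"
proof -
  let ?c = "\<lambda>m. inverse (real (Suc m))"
  have "AE \<omega> in Q. \<forall>i::int. \<forall>m. \<not> (emeasure (k \<omega>) {of_int i<..} \<le> ennreal (?c m) \<and>
      ennreal (?c m) < emeasure (k \<omega>) {of_int i - 1<..})"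
    unfolding AE_all_countable by (intro allI AE_Q_right)
  moreover have "AE \<omega> in Q. \<forall>i::int. \<forall>m. \<not> (emeasure (k \<omega>) {..<- of_int i} \<le> ennreal (?c m) \<and>
      ennreal (?c m) < emeasure (k \<omega>) {..<- of_int i + 1})"
    unfolding AE_all_countable by (intro allI AE_Q_left)
  ultimately show ?thesis
    using AE_space
  proof eventually_elim
    case (elim \<omega>)
    then have S: "sets (k \<omega>) = sets borel" by (simp add: space_Q sets_k)
    have ex: "\<exists>n. x < real n" for x using reals_Archimedean2 by blast
    have ex': "\<exists>n. - real n < x" for x using ex[of "- x"] by (simp add: minus_less_iff)
    have "emeasure (k \<omega>) UNIV = 0" if "emeasure (k \<omega>) {0<..} < \<infinity>"
    proof (rule tail_vanishes[where A="\<lambda>i. {of_int i<..}"])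
      show "(\<Inter>n. {real_of_int (int n)<..}) = {}" using ex by auto (metis less_asym)
      show "(\<Union>n. {real_of_int (- int n)<..}) = UNIV" using ex' by auto
    qed (use that elim(1) S in auto)
    moreover have "emeasure (k \<omega>) UNIV = 0" if "emeasure (k \<omega>) {..<0} < \<infinity>"
    \<comment> \<open>Negating the index makes the left half-lines decrease in i, as the right ones
      do.\<close>
    proof (rule tail_vanishes[where A="\<lambda>i. {..<- of_int i}"])
      show "(\<Inter>n. {..<- real_of_int (int n)}) = {}"
        using ex' by auto (metis less_asym)
      show "(\<Union>n. {..<- real_of_int (- int n)}) = UNIV" using ex by auto
    qed (use that elim(2) S in \<open>auto simp: algebra_simps\<close>)
    ultimately show ?case by (auto simp: less_top[symmetric])
  qed
qed

text \<open>Moving the origin from 0 to s alters each half-line by a bounded interval, which has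
  finite mass; the absence of atoms is carried over by covariance.\<close>

lemma clock_shift:
  assumes \<omega>: "\<omega> \<in> space \<Omega>" and cov: "cov \<omega> s" and "clock (k \<omega>)"
  shows "clock (k (shift s \<omega>))"
proof -
  interpret clock "k \<omega>" by fact
  note s\<omega> = shift_in_Omega[OF \<omega>, of s]
  show ?thesis
  proof
    show "sets (k (shift s \<omega>)) = sets borel" by (rule sets_k[OF s\<omega>])
    show "emeasure (k (shift s \<omega>)) {a..b} < \<infinity>" for a b by (rule finite_k[OF s\<omega>])
    show "emeasure (k (shift s \<omega>)) {t} = 0" for t
    proof -
      have "{u. u + s \<in> {t + s}} = {t}" by auto
      then show ?thesis using cov_emeasure[OF \<omega> cov, of "{t + s}"] diffuse by simp
    qed
    have "emeasure (k \<omega>) {0<..} \<le> emeasure (k \<omega>) ({s<..} \<union> {0..s})"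
      by (intro emeasure_mono) (auto simp: sets_k[OF \<omega>])
    also have "\<dots> \<le> emeasure (k \<omega>) {s<..} + emeasure (k \<omega>) {0..s}"
      by (intro emeasure_subadditive) (auto simp: sets_k[OF \<omega>])
    finally show "emeasure (k (shift s \<omega>)) {0<..} = \<infinity>"
      using infinite_right finite_Icc[of 0 s] by (auto simp: cov_Ioi[OF \<omega> cov] top_unique)
    have "emeasure (k \<omega>) {..<0} \<le> emeasure (k \<omega>) ({..<s} \<union> {s..0})"
      by (intro emeasure_mono) (auto simp: sets_k[OF \<omega>])
    also have "\<dots> \<le> emeasure (k \<omega>) {..<s} + emeasure (k \<omega>) {s..0}"
      by (intro emeasure_subadditive) (auto simp: sets_k[OF \<omega>])
    finally show "emeasure (k (shift s \<omega>)) {..<0} = \<infinity>"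
      using infinite_left finite_Icc[of s 0] by (auto simp: cov_Iio[OF \<omega> cov] top_unique)
  qed
qed

text \<open>Diffuseness is given under P0, so by the Palm formula almost every point s of the local
  time has no mass at s itself. An atom would be charged, contradicting this.\<close>

lemma AE_Q_clock: "AE \<omega> in Q. emeasure (k \<omega>) UNIV = 0 \<or> clock (k \<omega>)"
proof -
  have "AE \<omega> in P0. emeasure (k \<omega>) {0} = 0" using diffuse_k by eventually_elim simp
  then have "AE \<omega> in Q. AE s in k \<omega>. emeasure (k (shift s \<omega>)) {0} = 0"
    by (subst (asm) palm_AE) measurable
  with AE_Q_infinite AE_Q_cov_kernel AE_space show ?thesis
  proof eventually_elim
    case (elim \<omega>)
    then have \<omega>: "\<omega> \<in> space \<Omega>" by (simp add: space_Q)
    from elim(2,4) have ae: "AE s in k \<omega>. emeasure (k \<omega>) {s} = 0"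
    proof eventually_elim
      case (elim s)
      have "{u. u + s \<in> {s}} = {0}" by auto
      then show ?case using cov_emeasure[OF \<omega> elim(1), of "{s}"] elim(2) by simp
    qed
    have "emeasure (k \<omega>) {t} = 0" for t
    proof -
      have "AE s in k \<omega>. s \<in> {t} \<longrightarrow> emeasure (k \<omega>) {t} = 0"
        using ae by eventually_elim auto
      then have "emeasure (k \<omega>) {t} \<noteq> 0 \<Longrightarrow> AE s in k \<omega>. s \<notin> {t}" by simp
      moreover have "(AE s in k \<omega>. s \<notin> {t}) \<Longrightarrow> emeasure (k \<omega>) {t} = 0"
        by (subst (asm) AE_iff_measurable[of "{t}"]) (auto simp: sets_k[OF \<omega>] space_k[OF \<omega>])
      ultimately show ?thesis by blast
    qed
    then show ?case using elim(1) sets_k[OF \<omega>] finite_k[OF \<omega>] by (auto intro!: clock.intro)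
  qed
qed

text \<open>Infinite mass on both sides holds at almost every point of the local time under
  \<open>Q\<close>, hence at time 0 under P0. Paths without local time satisfy the condition
  vacuously, which removes the alternative of mass 0.\<close>

lemma AE_P0_clock: "AE \<omega> in P0. clock (k \<omega>)"
proof -
  have "AE \<omega> in Q. AE s in k \<omega>. emeasure (k (shift s \<omega>)) {0<..} = \<infinity> \<and> emeasure (k (shift s \<omega>)) {..<0} = \<infinity>"
    using AE_Q_clock AE_Q_cov_kernel AE_space
  proof eventually_elim
    case (elim \<omega>)
    then have \<omega>: "\<omega> \<in> space \<Omega>" by (simp add: space_Q)
    show ?case
    proof (cases "emeasure (k \<omega>) UNIV = 0")
      case True
      then show ?thesis by (intro AE_zero_measure) (simp add: space_k[OF \<omega>])
    next
      case False
      with elim have "clock (k \<omega>)" by simp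
      with elim(2) show ?thesis
        by (auto elim!: eventually_mono dest!: clock_shift[OF \<omega>] simp: clock_def)
    qed
  qed
  then have "AE \<omega> in P0. emeasure (k \<omega>) {0<..} = \<infinity> \<and> emeasure (k \<omega>) {..<0} = \<infinity>"
    by (subst palm_AE) measurable
  with diffuse_k AE_space show ?thesis
    by eventually_elim (auto simp: clock_def space_P0 sets_k finite_k[unfolded infinity_ennreal_def])
qed

section \<open>The inverse local time as a mass transport\<close>

definition inv_time :: "real \<Rightarrow> path \<Rightarrow> real" where
  "inv_time r \<omega> = real_of_ereal (INF q\<in>\<rat>. if r < cumul (k \<omega>) q then ereal q else \<infinity>)"

text \<open>The rational formula is the definition because it is measurable on all of \<Omega>.
  Where the infimum is infinite \<open>real_of_ereal\<close> returns 0; on clocks it is the true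
  inverse.\<close>

lemma inv_time_eq: "clock (k \<omega>) \<Longrightarrow> inv_time r \<omega> = cumul_inv (k \<omega>) r"
  unfolding inv_time_def by (subst clock.cumul_inv_INF_rat) simp_all

lemma measurable_inv_time [measurable]: "inv_time r \<in> borel_measurable \<Omega>"
proof -
  have [measurable]: "(\<lambda>\<omega>. cumul (k \<omega>) q) \<in> borel_measurable \<Omega>" for q
    unfolding cumul_def measure_def by measurable
  have "(\<lambda>\<omega>. INF q\<in>\<rat>. if r < cumul (k \<omega>) q then ereal q else \<infinity>) \<in> borel_measurable \<Omega>"
    by (intro borel_measurable_INF countable_rat) measurable
  then show ?thesis unfolding inv_time_def by measurable
qed

text \<open>The Palm formula is used twice around a transport of the local time by mass r: read at
  the sources the integral gives the law of the shifted path, read at the targets it gives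
  P0.\<close>

lemma emeasure_shift_inv_time:
  assumes A [measurable]: "A \<in> sets \<Omega>"
  shows "(\<integral>\<^sup>+\<omega>. indicator A (shift (inv_time r \<omega>) \<omega>) \<partial>P0) = emeasure P0 A"
proof -
  \<comment> \<open>A time weight of total mass 1, which gives a P0-probability the form of the
    right-hand side of the Palm formula.\<close>
  let ?h = "indicator {0..1::real} :: real \<Rightarrow> ennreal"
  have "(\<integral>\<^sup>+\<omega>. indicator A (shift (inv_time r \<omega>) \<omega>) \<partial>P0) =
      (\<integral>\<^sup>+\<omega>. \<integral>\<^sup>+s. indicator A (shift (inv_time r \<omega>) \<omega>) * ?h s \<partial>lborel \<partial>P0)"
    by (simp add: nn_integral_cmult)
  also have "\<dots> = (\<integral>\<^sup>+\<omega>. \<integral>\<^sup>+s. indicator A (shift (inv_time r (shift s \<omega>)) (shift s \<omega>)) * ?h s \<partial>k \<omega> \<partial>Q)"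
    by (rule palm[symmetric]) measurable
  \<comment> \<open>Now s is the target: the path is viewed from s, and the weight sits at the
    source, which lies at local time - r from s.\<close>
  also have "\<dots> = (\<integral>\<^sup>+\<omega>. \<integral>\<^sup>+s. indicator A (shift s \<omega>) * ?h (s + inv_time (- r) (shift s \<omega>)) \<partial>k \<omega> \<partial>Q)"
  proof (rule nn_integral_cong_AE)
    show "AE \<omega> in Q. (\<integral>\<^sup>+s. indicator A (shift (inv_time r (shift s \<omega>)) (shift s \<omega>)) * ?h s \<partial>k \<omega>) =
        (\<integral>\<^sup>+s. indicator A (shift s \<omega>) * ?h (s + inv_time (- r) (shift s \<omega>)) \<partial>k \<omega>)"
      using AE_Q_clock AE_Q_cov_kernel AE_space
    proof eventually_elim
      case (elim \<omega>)
      then have \<omega>: "\<omega> \<in> space \<Omega>" by (simp add: space_Q)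
      show ?case
      proof (cases "emeasure (k \<omega>) UNIV = 0")
        case True
        then show ?thesis by (intro nn_integral_cong_AE AE_zero_measure) (simp add: space_k[OF \<omega>])
      next
        case False
        with elim have "clock (k \<omega>)" by simp
        then interpret clock "k \<omega>" .
        have Ts: "AE s in k \<omega>. s + inv_time q (shift s \<omega>) = cumul_inv (k \<omega>) (cumul (k \<omega>) s + q)" for q
          using elim(2)
        proof eventually_elim
          case (elim s)
          then have "inv_time q (shift s \<omega>) = cumul_inv (k (shift s \<omega>)) q"
            by (intro inv_time_eq clock_shift \<omega> \<open>clock (k \<omega>)\<close>)
          also have "\<dots> = cumul_inv (k \<omega>) (cumul (k \<omega>) s + q) - s"
            using elim by (intro cumul_inv_shift) (auto simp: sets_k shift_in_Omega \<omega> cov_def)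
          finally show ?case by simp
        qed
        have [measurable]: "(\<lambda>s. shift s \<omega>) \<in> borel \<rightarrow>\<^sub>M \<Omega>" using \<omega> by simp
        have "(\<integral>\<^sup>+s. indicator A (shift (inv_time r (shift s \<omega>)) (shift s \<omega>)) * ?h s \<partial>k \<omega>) =
            (\<integral>\<^sup>+s. indicator A (shift (cumul_inv (k \<omega>) (cumul (k \<omega>) s + r)) \<omega>) * ?h s \<partial>k \<omega>)"
          by (rule nn_integral_cong_AE) (use Ts[of r] in \<open>eventually_elim, simp add: shift_shift\<close>)
        also have "\<dots> = (\<integral>\<^sup>+s. indicator A (shift s \<omega>) * ?h (cumul_inv (k \<omega>) (cumul (k \<omega>) s - r)) \<partial>k \<omega>)"
          by (rule nn_integral_transport[where \<psi>="\<lambda>s t. indicator A (shift t \<omega>) * ?h s"]) measurable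
        also have "\<dots> = (\<integral>\<^sup>+s. indicator A (shift s \<omega>) * ?h (s + inv_time (- r) (shift s \<omega>)) \<partial>k \<omega>)"
          by (rule nn_integral_cong_AE) (use Ts[of "- r"] in \<open>eventually_elim, simp\<close>)
        finally show ?thesis .
      qed
    qed
  qed
  also have "\<dots> = (\<integral>\<^sup>+\<omega>. \<integral>\<^sup>+s. indicator A \<omega> * ?h (s + inv_time (- r) \<omega>) \<partial>lborel \<partial>P0)"
    by (rule palm) measurable
  \<comment> \<open>The source is s plus a displacement depending only on the path, so the weight
    still integrates to 1 in s.\<close>
  also have "\<dots> = (\<integral>\<^sup>+\<omega>. indicator A \<omega> \<partial>P0)"
    by (simp add: nn_integral_cmult nn_integral_lborel_shift)
  also have "\<dots> = emeasure P0 A" by simp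
  finally show ?thesis .
qed

lemma distr_shift_inv_time: "distr P0 \<Omega> (\<lambda>\<omega>. shift (inv_time r \<omega>) \<omega>) = P0"
proof (rule measure_eqI)
  fix A assume "A \<in> sets (distr P0 \<Omega> (\<lambda>\<omega>. shift (inv_time r \<omega>) \<omega>))"
  then have [measurable]: "A \<in> sets \<Omega>" by simp
  have "emeasure (distr P0 \<Omega> (\<lambda>\<omega>. shift (inv_time r \<omega>) \<omega>)) A = (\<integral>\<^sup>+\<omega>. indicator A \<omega> \<partial>distr P0 \<Omega> (\<lambda>\<omega>. shift (inv_time r \<omega>) \<omega>))"
    by simp
  also have "\<dots> = emeasure P0 A"
    by (subst nn_integral_distr) (simp_all add: emeasure_shift_inv_time)
  finally show "emeasure (distr P0 \<Omega> (\<lambda>\<omega>. shift (inv_time r \<omega>) \<omega>)) A = emeasure P0 A" .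
qed (simp add: sets_P0)

text \<open>Invariance of P0 forces the value 0 at time S, so the increment path is the shifted path
  and has law P0. Independence is from an almost surely constant variable, whose events have
  probability 0 or 1.\<close>

lemma unbiased_shift_embeds:
  assumes rt: "random_time S" and S: "AE \<omega> in P0. S \<omega> = inv_time r \<omega>"
  shows "unbiased_shift P0 S \<and> embeds P0 S (return borel 0)"
proof -
  have S_meas [measurable]: "S \<in> borel_measurable \<Omega>" using rt by (simp add: random_time_def)
  have BS [measurable]: "(\<lambda>\<omega>. \<omega> (S \<omega>)) \<in> borel_measurable P0"
    by (rule measurable_coordinate_at) measurable
  have "AE \<omega> in distr P0 \<Omega> (\<lambda>\<omega>. shift (inv_time r \<omega>) \<omega>). \<omega> 0 = 0"
    unfolding distr_shift_inv_time using BM by (simp add: two_sided_standard_BM_def)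
  then have "AE \<omega> in P0. shift (inv_time r \<omega>) \<omega> 0 = 0"
    by (rule AE_distrD[rotated]) measurable
  with S have zero: "AE \<omega> in P0. \<omega> (S \<omega>) = 0"
    by eventually_elim (simp add: shift_def)
  have "distr P0 \<Omega> (\<lambda>\<omega>. pinned (S \<omega>) \<omega>) = distr P0 \<Omega> (\<lambda>\<omega>. shift (inv_time r \<omega>) \<omega>)"
  proof (rule distr_cong_AE)
    show "AE \<omega> in P0. pinned (S \<omega>) \<omega> = shift (inv_time r \<omega>) \<omega>"
      using S zero by eventually_elim (simp add: pinned_def shift_def)
  qed measurable
  then have "two_sided_standard_BM P0 (\<lambda>\<omega>. pinned (S \<omega>) \<omega>)"
    by (intro BM_transfer[OF BM]) (simp_all add: distr_shift_inv_time P0.prob_space_axioms)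
  moreover have "P0.indep_set {(\<lambda>\<omega>. pinned (S \<omega>) \<omega>) -` A \<inter> space P0 | A. A \<in> sets \<Omega>}
      {(\<lambda>\<omega>. \<omega> (S \<omega>)) -` C \<inter> space P0 | C. C \<in> sets (borel :: real measure)}"
  proof (rule P0.indep_setI)
    have 1: "(\<lambda>\<omega>. pinned (S \<omega>) \<omega>) -` A \<inter> space P0 \<in> P0.events" if "A \<in> sets \<Omega>" for A
      by (rule measurable_sets[OF _ that]) measurable
    have 2: "(\<lambda>\<omega>. \<omega> (S \<omega>)) -` C \<inter> space P0 \<in> P0.events" if "C \<in> sets borel" for C
      by (rule measurable_sets[OF BS that])
    show "{(\<lambda>\<omega>. pinned (S \<omega>) \<omega>) -` A \<inter> space P0 | A. A \<in> sets \<Omega>} \<subseteq> P0.events"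
      using 1 by auto
    show "{(\<lambda>\<omega>. \<omega> (S \<omega>)) -` C \<inter> space P0 | C. C \<in> sets (borel :: real measure)} \<subseteq> P0.events"
      using 2 by auto
    fix a b
    assume "a \<in> {(\<lambda>\<omega>. pinned (S \<omega>) \<omega>) -` A \<inter> space P0 | A. A \<in> sets \<Omega>}"
      and "b \<in> {(\<lambda>\<omega>. \<omega> (S \<omega>)) -` C \<inter> space P0 | C. C \<in> sets (borel :: real measure)}"
    then obtain C where a: "a \<in> P0.events" and C: "C \<in> sets borel" and b: "b = (\<lambda>\<omega>. \<omega> (S \<omega>)) -` C \<inter> space P0"
      using 1 by auto
    have bev: "b \<in> P0.events" unfolding b by (rule 2[OF C])
    show "P0.prob (a \<inter> b) = P0.prob a * P0.prob b"
    proof (cases "0 \<in> C")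
      case True
      have full: "AE \<omega> in P0. \<omega> \<in> b" using zero AE_space by eventually_elim (simp add: b True)
      then have "P0.prob b = 1" using bev by (subst P0.prob_eq_1) auto
      moreover have "P0.prob (a \<inter> b) = P0.prob a"
        using full a bev by (intro P0.finite_measure_eq_AE) (auto elim: eventually_mono)
      ultimately show ?thesis by simp
    next
      case False
      have null: "AE \<omega> in P0. \<omega> \<notin> b" using zero AE_space by eventually_elim (simp add: b False)
      then have "P0.prob b = 0" using bev by (subst P0.prob_eq_0) auto
      moreover have "P0.prob (a \<inter> b) = P0.prob {}"
        using null a bev by (intro P0.finite_measure_eq_AE) (auto elim: eventually_mono)
      ultimately show ?thesis by simp
    qed
  qed
  moreover have "distr P0 borel (\<lambda>\<omega>. \<omega> (S \<omega>)) = return borel 0"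
  proof -
    have "distr P0 borel (\<lambda>\<omega>. \<omega> (S \<omega>)) = distr P0 borel (\<lambda>_. 0)"
      by (rule distr_cong_AE) (use zero in auto)
    also have "\<dots> = return borel 0" by (simp add: P0.distr_const)
    finally show ?thesis .
  qed
  ultimately show ?thesis
    using rt unfolding unbiased_shift_def embeds_def pinned_def by blast
qed

end

section \<open>From a local time to a locally finite kernel\<close>

lemma inverse_local_time_eq:
  "clock (l 0 \<omega>) \<Longrightarrow> inverse_local_time l r \<omega> = ereal (cumul_inv (l 0 \<omega>) r)"
  by (simp add: inverse_local_time_def clock.Sup_level_nonneg clock.Sup_level_neg)

text \<open>Countably many windows keep the property measurable in the path.\<close>

definition locally_finite :: "real measure \<Rightarrow> bool" where
  "locally_finite \<mu> \<longleftrightarrow> (\<forall>n::nat. emeasure \<mu> {-real n..real n} < \<infinity>)"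

lemma locally_finite_Icc:
  assumes "locally_finite \<mu>" "sets \<mu> = sets borel" shows "emeasure \<mu> {a..b} < \<infinity>"
proof -
  obtain n where "max \<bar>a\<bar> \<bar>b\<bar> < real n" using reals_Archimedean2 by blast
  then have "{a..b} \<subseteq> {-real n..real n}" by auto
  then have "emeasure \<mu> {a..b} \<le> emeasure \<mu> {-real n..real n}" by (rule emeasure_mono) (simp add: assms)
  also have "\<dots> < \<infinity>" using assms(1) by (simp add: locally_finite_def)
  finally show ?thesis .
qed

text \<open>The null measure is finite, diffuse and carried by any set, so it is a safe value on
  exceptional paths.\<close>

definition locally_finite_version :: "(path \<Rightarrow> real measure) \<Rightarrow> path \<Rightarrow> real measure" where
  "locally_finite_version \<xi> \<omega> = (if locally_finite (\<xi> \<omega>) then \<xi> \<omega> else null_measure borel)"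

text \<open>The modification must be invisible under every P_x, after each fixed shift, and at
  almost every level along one path. The first comes from the finiteness hypothesis under each P_x,
  the second from covariance, the third from Fubini.\<close>

lemma brownian_kernel_local_time:
  assumes P0: "law_of_two_sided_standard_BM P0" and l: "local_time P0 l"
  shows "brownian_kernel P0 (locally_finite_version (l 0))"
    and "AE \<omega> in P0. locally_finite_version (l 0) \<omega> = l 0 \<omega>"
proof -
  let ?k = "locally_finite_version (l 0)"
  have S [measurable_cong]: "sets P0 = sets \<Omega>" and BM: "two_sided_standard_BM P0 (\<lambda>\<omega>. \<omega>)"
    using P0 by (simp_all add: law_of_two_sided_standard_BM_def)
  interpret P0: prob_space P0 using BM by (simp add: two_sided_standard_BM_def)
  interpret pair_sigma_finite P0 lborel ..
  have space_P0: "space P0 = space \<Omega>" using sets_eq_imp_space_eq[OF S] .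
  from l[unfolded local_time_def] have rm: "random_measure P0 (l 0)"
    and l_occ: "occupation_formula P0 l"
    and l_diffuse: "\<And>x. AE \<omega> in started_at P0 x. \<forall>t. emeasure (l 0 \<omega>) {t} = 0"
    and l_cov: "\<And>x t C. C \<in> sets borel \<Longrightarrow> AE \<omega> in started_at P0 x.
        emeasure (l 0 (shift t \<omega>)) ((\<lambda>s. s - t) ` C) = emeasure (l 0 \<omega>) C"
    and l_translate: "\<And>y \<omega>. \<omega> \<in> space \<Omega> \<Longrightarrow> l y \<omega> = l 0 (\<lambda>s. \<omega> s - y)"
    and l_carried: "\<And>x \<omega>. \<omega> \<in> space \<Omega> \<Longrightarrow> (\<integral>\<^sup>+t. indicator {t. \<omega> t \<noteq> x} t \<partial>l x \<omega>) = 0"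
    by blast+
  have sets_l: "sets (l 0 \<omega>) = sets borel" if "\<omega> \<in> space \<Omega>" for \<omega>
    using rm that by (simp add: random_measure_def)
  have meas_l [measurable]: "(\<lambda>\<omega>. emeasure (l 0 \<omega>) C) \<in> borel_measurable \<Omega>" if "C \<in> sets borel" for C
    using rm that by (simp add: random_measure_def)
  have started: "AE \<omega> in P0. P (lift x \<omega>)" if "AE \<omega> in started_at P0 x. P \<omega>" for P x
    using that unfolding started_at_def lift_def[symmetric]
    by (rule AE_distrD[rotated]) measurable
  have fin_x: "AE \<omega> in P0. locally_finite (l 0 (lift x \<omega>))" for x
  proof (rule started)
    have "AE \<omega> in started_at P0 x. \<forall>K. compact K \<longrightarrow> emeasure (l 0 \<omega>) K < \<infinity>"
      using rm by (simp add: random_measure_def)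
    then show "AE \<omega> in started_at P0 x. locally_finite (l 0 \<omega>)"
      by eventually_elim (simp add: locally_finite_def)
  qed
  have k_eq: "?k \<omega> = l 0 \<omega>" if "locally_finite (l 0 \<omega>)" for \<omega>
    using that by (simp add: locally_finite_version_def)
  show "AE \<omega> in P0. ?k \<omega> = l 0 \<omega>"
    using fin_x[of 0] by eventually_elim (simp add: lift_def k_eq)
  have [measurable]: "Measurable.pred \<Omega> (\<lambda>\<omega>. locally_finite (l 0 \<omega>))"
    unfolding locally_finite_def by measurable
  show "brownian_kernel P0 ?k"
  proof
    show "sets P0 = sets \<Omega>" "two_sided_standard_BM P0 (\<lambda>\<omega>. \<omega>)" by fact+
    show "sets (?k \<omega>) = sets borel" if "\<omega> \<in> space \<Omega>" for \<omega>
      using that by (simp add: locally_finite_version_def sets_l)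
    show "(\<lambda>\<omega>. emeasure (?k \<omega>) C) \<in> borel_measurable \<Omega>" if "C \<in> sets borel" for C
    proof -
      have "(\<lambda>\<omega>. emeasure (?k \<omega>) C) = (\<lambda>\<omega>. if locally_finite (l 0 \<omega>) then emeasure (l 0 \<omega>) C else 0)"
        by (auto simp: locally_finite_version_def)
      then show ?thesis using that by simp
    qed
    show "emeasure (?k \<omega>) {a..b} < \<infinity>" if "\<omega> \<in> space \<Omega>" for \<omega> a b
      using that by (simp add: locally_finite_version_def locally_finite_Icc[unfolded infinity_ennreal_def] sets_l)
    show "AE s in ?k \<omega>. \<omega> s = 0" if \<omega>: "\<omega> \<in> space \<Omega>" for \<omega>
    proof (cases "locally_finite (l 0 \<omega>)")
      case True
      have "open {s. \<omega> s \<noteq> 0}"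
        using \<omega> by (intro open_Collect_neq) (auto simp: space_Omega)
      then have [measurable]: "{s. \<omega> s \<noteq> 0} \<in> sets (l 0 \<omega>)" by (simp add: sets_l[OF \<omega>])
      have "(\<integral>\<^sup>+s. indicator {s. \<omega> s \<noteq> 0} s \<partial>l 0 \<omega>) = 0"
        using \<omega> by (rule l_carried)
      then have "emeasure (l 0 \<omega>) {s. \<omega> s \<noteq> 0} = 0" by simp
      then have "AE s in l 0 \<omega>. \<omega> s = 0"
        by (intro AE_I[where N="{s. \<omega> s \<noteq> 0}"]) auto
      then show ?thesis unfolding k_eq[OF True] .
    next
      case False
      then show ?thesis by (intro AE_zero_measure) (simp add: locally_finite_version_def)
    qed
    show "AE \<omega> in P0. \<forall>t. emeasure (?k \<omega>) {t} = 0"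
    proof -
      have "AE \<omega> in P0. \<forall>t. emeasure (l 0 (lift 0 \<omega>)) {t} = 0"
        by (rule started) (rule l_diffuse)
      then show ?thesis
        by eventually_elim (simp add: locally_finite_version_def lift_def)
    qed
    show "AE \<omega> in P0. emeasure (?k (shift t (lift x \<omega>))) ((\<lambda>s. s - t) ` C) = emeasure (?k (lift x \<omega>)) C"
      if C: "C \<in> sets borel" for C t x
    proof -
      have cov: "AE \<omega> in P0. emeasure (l 0 (shift t (lift x \<omega>))) ((\<lambda>s. s - t) ` D) = emeasure (l 0 (lift x \<omega>)) D"
        if "D \<in> sets borel" for D
        using l_cov[OF that, of t x] by (rule started)
      \<comment> \<open>These windows are carried onto [-n, n], so local finiteness passes from the
        lifted path to its shift by t.\<close>
      have "AE \<omega> in P0. \<forall>n. emeasure (l 0 (shift t (lift x \<omega>))) ((\<lambda>s. s - t) ` {t - real n..t + real n}) =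
          emeasure (l 0 (lift x \<omega>)) {t - real n..t + real n}"
        unfolding AE_all_countable by (intro allI cov) simp
      with cov[OF C] fin_x[of x] AE_space show ?thesis
      proof eventually_elim
        case (elim \<omega>)
        then have \<omega>: "lift x \<omega> \<in> space \<Omega>" by (simp add: space_P0 lift_in_Omega)
        have img: "(\<lambda>s. s - t) ` {t - real n..t + real n} = {- real n..real n}" for n
          by (auto simp: image_iff intro!: bexI[of _ "_ + t"])
        have "locally_finite (l 0 (shift t (lift x \<omega>)))"
          unfolding locally_finite_def
          using elim(4) locally_finite_Icc[OF elim(2) sets_l[OF \<omega>]] by (simp only: img simp_thms)
        with elim show ?case by (simp add: k_eq)
      qed
    qed
    show "AE \<omega> in P0. (\<integral>\<^sup>+x. emeasure (?k (lift (- x) \<omega>)) B \<partial>lborel) = emeasure lborel B"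
      if B: "B \<in> sets borel" for B
    proof -
      have "(\<lambda>p. indicator B (snd p)) \<in> borel_measurable (borel :: (real \<times> real) measure)"
        using B by (intro borel_measurable_indicator' measurable_compose[OF measurable_snd])
                   (simp_all add: borel_prod[symmetric])
      then have occ: "AE \<omega> in P0. (\<integral>\<^sup>+s. ennreal (indicator B s) \<partial>lborel) =
          (\<integral>\<^sup>+x. \<integral>\<^sup>+s. ennreal (indicator B s) \<partial>l x \<omega> \<partial>lborel)"
        using l_occ[unfolded occupation_formula_def, rule_format, of "\<lambda>p. indicator B (snd p)"] by simp
      have "{z \<in> space (P0 \<Otimes>\<^sub>M lborel). locally_finite (l 0 (lift (- snd z) (fst z)))} \<in> sets (P0 \<Otimes>\<^sub>M lborel)"
        by measurable
      \<comment> \<open>For each x the exceptional paths are null; Fubini makes the exceptional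
        levels Lebesgue-null for almost every path, which the integral over x ignores.\<close>
      from AE_commute[OF this]
      have "AE \<omega> in P0. AE x in lborel. locally_finite (l 0 (lift (- x) \<omega>))"
        using fin_x by simp
      with occ AE_space show ?thesis
      proof eventually_elim
        case (elim \<omega>)
        then have \<omega>: "\<omega> \<in> space \<Omega>" by (simp add: space_P0)
        have lx: "l x \<omega> = l 0 (lift (- x) \<omega>)" for x
          using l_translate[OF \<omega>, of x] by (simp add: lift_def)
        have "(\<integral>\<^sup>+x. emeasure (?k (lift (- x) \<omega>)) B \<partial>lborel) = (\<integral>\<^sup>+x. \<integral>\<^sup>+s. ennreal (indicator B s) \<partial>l x \<omega> \<partial>lborel)"
        proof (rule nn_integral_cong_AE)
          show "AE x in lborel. emeasure (?k (lift (- x) \<omega>)) B = (\<integral>\<^sup>+s. ennreal (indicator B s) \<partial>l x \<omega>)"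
            using elim(3)
            by eventually_elim (use B in \<open>simp add: k_eq lx ennreal_indicator sets_l lift_in_Omega \<omega>\<close>)
        qed
        also have "\<dots> = (\<integral>\<^sup>+s. ennreal (indicator B s) \<partial>lborel)" using elim(1) ..
        also have "\<dots> = emeasure lborel B" using B by (simp add: ennreal_indicator)
        finally show ?case .
      qed
    qed
  qed
qed

theorem theorem1p1:
  fixes P0 :: "path measure" and l :: "real \<Rightarrow> path \<Rightarrow> real measure" and r :: real
  assumes "law_of_two_sided_standard_BM P0"
    and "local_time P0 l"
  shows "(\<exists>T. random_time_version P0 (inverse_local_time l r) T) \<and>
    (\<forall>T. random_time_version P0 (inverse_local_time l r) T \<longrightarrow>
       unbiased_shift P0 T \<and> embeds P0 T (return borel 0))"
proof -
  interpret brownian_kernel P0 "locally_finite_version (l 0)"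
    using assms by (rule brownian_kernel_local_time)
  \<comment> \<open>Every version agrees almost surely with the measurable
    \<open>inv_time r\<close>, which thus both witnesses existence and carries the conclusion to all
    versions.\<close>
  have eq: "AE \<omega> in P0. inverse_local_time l r \<omega> = ereal (inv_time r \<omega>)"
    using brownian_kernel_local_time(2)[OF assms] AE_P0_clock
    by eventually_elim (metis inv_time_eq inverse_local_time_eq)
  show ?thesis
  proof (intro conjI exI allI impI)
    show "random_time_version P0 (inverse_local_time l r) (inv_time r)"
      using eq by (auto simp: random_time_version_def random_time_def elim: eventually_mono)
    fix S assume S: "random_time_version P0 (inverse_local_time l r) S"
    then have "AE \<omega> in P0. ereal (S \<omega>) = inverse_local_time l r \<omega>" by (simp add: random_time_version_def)
    with eq have "AE \<omega> in P0. S \<omega> = inv_time r \<omega>" by eventually_elim simp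
    with S have *: "unbiased_shift P0 S \<and> embeds P0 S (return borel 0)"
      by (intro unbiased_shift_embeds) (auto simp: random_time_version_def)
    then show "unbiased_shift P0 S" "embeds P0 S (return borel 0)" by auto
  qed
qed

end
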